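(* There is an algorithm that, given an instance $(V,E,T,r,D)$ of the Directed Diameter Constrained Steiner Tree (DDCST) problem, solves it in time $O(3^{|T|}\cdot n^3)$, where $n=|V|$.
   Context: DDCST problem: the input is $(V,E,T,r,D)$, where $G=(V,E)$ is a directed graph with non-negative edge weights $E(i,j)$ on ordered pairs (weight $\infty$ indicating an absent edge), with $E(i,i)=0$ and $E(i,j)$, $E(j,i)$ possibly unrelated for $i\neq j$; $T\subseteq V$ is a set of terminals; $r\in V\setminus T$ is a root; and $D>0$ is an integer. The output is the minimum weight of a directed sub-tree of $G$ rooted at $r$ (edges directed away from $r$) containing all vertices of $T$ and having diameter at most $D$, or FAIL if no such sub-tree exists. The weight of a sub-tree is the sum of its edge weights; the diameter of a rooted directed tree is the maximum number of edges (ignoring weights) on a path from the root to a leaf. *)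

theory Defs
  imports "HOL-Library.Extended_Nonnegative_Real" "Graph_Theory.Graph_Theory"
begin

section \<open>The problem\<close>

text \<open>
  Weights are extended nonnegative reals; \<open>\<infinity>\<close> marks an absent edge. The values of \<open>E\<close> outside
  \<open>V \<times> V\<close> are irrelevant.
\<close>

definition ddcst_instance ::
    "'v set \<Rightarrow> ('v \<Rightarrow> 'v \<Rightarrow> ennreal) \<Rightarrow> 'v set \<Rightarrow> 'v \<Rightarrow> nat \<Rightarrow> bool" where
  "ddcst_instance V E T r D \<longleftrightarrow>
     finite V \<and> (\<forall>i\<in>V. E i i = 0) \<and> T \<subseteq> V \<and> r \<in> V - T \<and> D > 0"

definition graph_of :: "'v set \<Rightarrow> ('v \<Rightarrow> 'v \<Rightarrow> ennreal) \<Rightarrow> 'v pair_pre_digraph" where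
  "graph_of V E = \<lparr>pverts = V, parcs = {(i, j). i \<in> V \<and> j \<in> V \<and> E i j \<noteq> \<infinity>}\<rparr>"

text \<open>
  Uniqueness ranges over all walks, not only paths, so it also excludes loops and cycles and forces
  every edge to point away from \<open>r\<close>.
\<close>

definition rooted_tree :: "'v pair_pre_digraph \<Rightarrow> 'v \<Rightarrow> bool" where
  "rooted_tree H r \<longleftrightarrow>
     wf_digraph (with_proj H) \<and> r \<in> pverts H \<and>
     (\<forall>v\<in>pverts H. \<exists>!p. pre_digraph.awalk (with_proj H) r p v)"

definition leaves :: "'v pair_pre_digraph \<Rightarrow> 'v set" where
  "leaves H = {v \<in> pverts H. out_arcs (with_proj H) v = {}}"

definition tree_diameter :: "'v pair_pre_digraph \<Rightarrow> 'v \<Rightarrow> nat" where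
  "tree_diameter H r =
     Max {length p | p v. v \<in> leaves H \<and> pre_digraph.awalk (with_proj H) r p v}"

definition tree_weight :: "('v \<Rightarrow> 'v \<Rightarrow> ennreal) \<Rightarrow> 'v pair_pre_digraph \<Rightarrow> ennreal" where
  "tree_weight E H = (\<Sum>(i, j)\<in>parcs H. E i j)"

definition feasible_tree ::
    "'v set \<Rightarrow> ('v \<Rightarrow> 'v \<Rightarrow> ennreal) \<Rightarrow> 'v set \<Rightarrow> 'v \<Rightarrow> nat \<Rightarrow> 'v pair_pre_digraph \<Rightarrow> bool" where
  "feasible_tree V E T r D H \<longleftrightarrow>
     subgraph (with_proj H) (with_proj (graph_of V E)) \<and> rooted_tree H r \<and>
     T \<subseteq> pverts H \<and> tree_diameter H r \<le> D"

text \<open>\<open>None\<close> stands for FAIL.\<close>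

fun ddcst_solution ::
    "'v set \<Rightarrow> ('v \<Rightarrow> 'v \<Rightarrow> ennreal) \<Rightarrow> 'v set \<Rightarrow> 'v \<Rightarrow> nat \<Rightarrow> ennreal option \<Rightarrow> bool" where
  "ddcst_solution V E T r D None \<longleftrightarrow> \<not> (\<exists>H. feasible_tree V E T r D H)"
| "ddcst_solution V E T r D (Some w) \<longleftrightarrow>
     (\<exists>H. feasible_tree V E T r D H \<and> tree_weight E H = w) \<and>
     (\<forall>H. feasible_tree V E T r D H \<longrightarrow> w \<le> tree_weight E H)"


section \<open>The model of computation\<close>

text \<open>
  Programs for a unit-cost random access machine. Memory consists of finitely many (per program)
  named arrays of unbounded length, one family holding natural numbers and one holding weights; a
  scalar is cell \<open>0\<close> of an array. Numbers can only be added, subtracted (truncated at 0) and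
  compared: multiplication and bit operations are deliberately absent, because unit-cost
  multiplication on unbounded numbers is unreasonably powerful. Weights can only be added and
  compared.
\<close>

datatype nexp =
    Const nat
  | NCell string nexp
  | NAdd nexp nexp
  | NSub nexp nexp

datatype wexp =
    WZero
  | WInf
  | WCell string nexp
  | WAdd wexp wexp

datatype bexp =
    NLess nexp nexp
  | WLess wexp wexp
  | BNot bexp
  | BAnd bexp bexp

datatype com =
    Skip
  | NAssign string nexp nexp
  | WAssign string nexp wexp
  | Seq com com
  | Cond bexp com com
  | While bexp com

record store =
  nats :: "string \<Rightarrow> nat \<Rightarrow> nat"
  weights :: "string \<Rightarrow> nat \<Rightarrow> ennreal"

fun nval :: "nexp \<Rightarrow> store \<Rightarrow> nat" where
  "nval (Const c) s = c"
| "nval (NCell a e) s = nats s a (nval e s)"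
| "nval (NAdd e f) s = nval e s + nval f s"
| "nval (NSub e f) s = nval e s - nval f s"

fun wval :: "wexp \<Rightarrow> store \<Rightarrow> ennreal" where
  "wval WZero s = 0"
| "wval WInf s = \<infinity>"
| "wval (WCell a e) s = weights s a (nval e s)"
| "wval (WAdd e f) s = wval e s + wval f s"

fun bval :: "bexp \<Rightarrow> store \<Rightarrow> bool" where
  "bval (NLess e f) s \<longleftrightarrow> nval e s < nval f s"
| "bval (WLess e f) s \<longleftrightarrow> wval e s < wval f s"
| "bval (BNot b) s \<longleftrightarrow> \<not> bval b s"
| "bval (BAnd b c) s \<longleftrightarrow> bval b s \<and> bval c s"

text \<open>One time unit for every constant, memory access and operation evaluated.\<close>

fun ncost :: "nexp \<Rightarrow> nat" where
  "ncost (Const c) = 1"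
| "ncost (NCell a e) = 1 + ncost e"
| "ncost (NAdd e f) = 1 + ncost e + ncost f"
| "ncost (NSub e f) = 1 + ncost e + ncost f"

fun wcost :: "wexp \<Rightarrow> nat" where
  "wcost WZero = 1"
| "wcost WInf = 1"
| "wcost (WCell a e) = 1 + ncost e"
| "wcost (WAdd e f) = 1 + wcost e + wcost f"

fun bcost :: "bexp \<Rightarrow> nat" where
  "bcost (NLess e f) = 1 + ncost e + ncost f"
| "bcost (WLess e f) = 1 + wcost e + wcost f"
| "bcost (BNot b) = 1 + bcost b"
| "bcost (BAnd b c) = 1 + bcost b + bcost c"

definition nupd :: "string \<Rightarrow> nat \<Rightarrow> nat \<Rightarrow> store \<Rightarrow> store" where
  "nupd a i x s = s\<lparr>nats := (nats s)(a := (nats s a)(i := x))\<rparr>"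

definition wupd :: "string \<Rightarrow> nat \<Rightarrow> ennreal \<Rightarrow> store \<Rightarrow> store" where
  "wupd a i x s = s\<lparr>weights := (weights s)(a := (weights s a)(i := x))\<rparr>"

text \<open>\<open>exec c s t s'\<close>: started in \<open>s\<close>, the program \<open>c\<close> halts in \<open>s'\<close> after exactly \<open>t\<close> time units.\<close>

inductive exec :: "com \<Rightarrow> store \<Rightarrow> nat \<Rightarrow> store \<Rightarrow> bool" where
  Skip: "exec Skip s 1 s"
| NAssign: "exec (NAssign a e f) s (1 + ncost e + ncost f) (nupd a (nval e s) (nval f s) s)"
| WAssign: "exec (WAssign a e f) s (1 + ncost e + wcost f) (wupd a (nval e s) (wval f s) s)"
| Seq: "exec c s t s' \<Longrightarrow> exec d s' u s'' \<Longrightarrow> exec (Seq c d) s (t + u) s''"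
| CondTrue: "bval b s \<Longrightarrow> exec c s t s' \<Longrightarrow> exec (Cond b c d) s (1 + bcost b + t) s'"
| CondFalse: "\<not> bval b s \<Longrightarrow> exec d s t s' \<Longrightarrow> exec (Cond b c d) s (1 + bcost b + t) s'"
| WhileFalse: "\<not> bval b s \<Longrightarrow> exec (While b c) s (1 + bcost b) s"
| WhileTrue: "bval b s \<Longrightarrow> exec c s t s' \<Longrightarrow> exec (While b c) s' u s'' \<Longrightarrow>
    exec (While b c) s (1 + bcost b + t + u) s''"

inductive_cases SkipE: "exec Skip s t s'"
inductive_cases NAssignE: "exec (NAssign a e f) s t s'"
inductive_cases WAssignE: "exec (WAssign a e f) s t s'"
inductive_cases SeqE: "exec (Seq c d) s t s'"
inductive_cases CondE: "exec (Cond b c d) s t s'"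
inductive_cases WhileE: "exec (While b c) s t s'"

lemma exec_deterministic:
  "exec c s t s' \<Longrightarrow> exec c s u s'' \<Longrightarrow> t = u \<and> s' = s''"
proof (induction arbitrary: u s'' rule: exec.induct)
  case (Skip s)
  then show ?case by (auto elim: SkipE)
next
  case (NAssign a e f s)
  then show ?case by (auto elim: NAssignE)
next
  case (WAssign a e f s)
  then show ?case by (auto elim: WAssignE)
next
  case (Seq c s t s1 d t2 s2)
  from Seq.prems obtain t' s1' t2'
    where *: "u = t' + t2'" "exec c s t' s1'" "exec d s1' t2' s''" by (rule SeqE)
  from Seq.IH(1)[OF *(2)] Seq.IH(2) * show ?case by simp
next
  case (CondTrue b s c t s1 d)
  from CondTrue.prems CondTrue.hyps obtain t' where "u = 1 + bcost b + t'" "exec c s t' s''"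
    by (auto elim: CondE)
  with CondTrue.IH show ?case by simp
next
  case (CondFalse b s d t s1 c)
  from CondFalse.prems CondFalse.hyps obtain t' where "u = 1 + bcost b + t'" "exec d s t' s''"
    by (auto elim: CondE)
  with CondFalse.IH show ?case by simp
next
  case (WhileFalse b s c)
  from WhileFalse.prems show ?case by (rule WhileE) (simp_all add: WhileFalse.hyps)
next
  case (WhileTrue b s c t s1 t2 s2)
  from WhileTrue.prems obtain t' s1' t2'
    where *: "u = 1 + bcost b + t' + t2'" "exec c s t' s1'" "exec (While b c) s1' t2' s''"
    by (rule WhileE) (use WhileTrue.hyps(1) in auto)
  from WhileTrue.IH(1)[OF *(2)] WhileTrue.IH(2) * show ?case by simp
qed


section \<open>Input and output\<close>

text \<open>
  The vertices are presented to the machine as \<open>0, \<dots>, n - 1\<close> and the terminals as a list, both in an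
  arbitrary order. The weight matrix is stored row by row. Cells not mentioned here are left
  unconstrained, so a program cannot rely on their initial contents.
\<close>

definition encodes ::
    "store \<Rightarrow> 'v set \<Rightarrow> ('v \<Rightarrow> 'v \<Rightarrow> ennreal) \<Rightarrow> 'v set \<Rightarrow> 'v \<Rightarrow> nat \<Rightarrow> bool" where
  "encodes s V E T r D \<longleftrightarrow>
     (\<exists>\<nu>. bij_betw \<nu> {..<card V} V \<and>
        nats s ''n'' 0 = card V \<and>
        nats s ''k'' 0 = card T \<and>
        nats s ''D'' 0 = D \<and>
        nats s ''r'' 0 < card V \<and> \<nu> (nats s ''r'' 0) = r \<and>
        (\<forall>j<card T. nats s ''T'' j < card V) \<and>
        bij_betw (\<lambda>j. \<nu> (nats s ''T'' j)) {..<card T} T \<and>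
        (\<forall>i<card V. \<forall>j<card V. weights s ''E'' (i * card V + j) = E (\<nu> i) (\<nu> j)))"

definition result :: "store \<Rightarrow> ennreal option" where
  "result s = (if nats s ''fail'' 0 = 0 then Some (weights s ''opt'' 0) else None)"

end

theory Submission
  imports Defs "HOL-Library.Nat_Bijection"
begin

text \<open>
  Dynamic programming over the depth bound, the root \<open>v\<close> and the set \<open>X\<close> of terminals to be reached.
  An optimal tree of depth at most \<open>d + 1\<close> at \<open>v\<close> partitions \<open>X\<close> among the branches at \<open>v\<close>, each of
  which is an arc \<open>(v, u)\<close> followed by a tree of depth at most \<open>d\<close> at \<open>u\<close>; since \<open>E v v = 0\<close>, the
  choice \<open>u = v\<close> covers shallower trees and terminals at \<open>v\<close> itself. The subtrees chosen by the
  recursion may overlap, but their union is an arc set that reaches every terminal within the depth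
  bound, and a breadth-first tree of this arc set is feasible and no heavier. Depths above \<open>n\<close> are
  useless, so \<open>min n D + 1\<close> rounds suffice; each takes \<open>n * 3 ^ k\<close> steps for the partitions, because
  there are \<open>3 ^ k\<close> pairs of disjoint subsets of \<open>k\<close> terminals, and \<open>n\<^sup>2 * 2 ^ k\<close> steps for the arcs.
\<close>

text \<open>Trees are awkward on both sides of the comparison: a union of trees need not be a tree,
  and a digraph with unique walks offers nothing to recurse on. So arc sets with bounded
  reachability carry the upper bound, and a parent function together with a depth function carries
  the lower bound. The free loop at \<open>v\<close> lets every branch use up exactly its depth
  allowance, so no case distinction on the height of a subtree arises. On the machine the obstacles
  are the missing multiplication and bit operations. Products for addresses and powers are tabulated
  by repeated addition, and the union of disjoint masks is replaced by their sum. Splitting off the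
  block of the largest element \<open>j\<close> allows gluing in place: entries with top bit
  \<open>j\<close> are computed from entries below \<open>2 ^ j\<close>, and work of order
  \<open>3 ^ j\<close> for each \<open>j\<close> adds up to order \<open>3 ^ k\<close>. As cells
  start with arbitrary contents, every target of a running minimum is first set to infinity. The
  numerical constants are crude bounds on the costs of loop bodies.\<close>

section \<open>The recurrence\<close>

text \<open>
  The least total cost of partitioning \<open>X\<close> into blocks, a block \<open>Y\<close> costing \<open>h Y\<close>. Splitting off the
  block of the largest element makes it computable bit by bit: \<open>partition_min h Q\<close> is needed only for
  sets \<open>Q\<close> of smaller bits.
\<close>

function partition_min :: "(nat set \<Rightarrow> ennreal) \<Rightarrow> nat set \<Rightarrow> ennreal" where
  "partition_min h X =
     (if finite X \<and> X \<noteq> {}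
      then INF Q\<in>Pow (X - {Max X}). h (X - Q) + partition_min h Q else 0)"
  by pat_completeness auto
termination
proof (relation "measure (card \<circ> snd)", goal_cases)
  case (2 h X Q)
  then have "Q \<subset> X" using Max_in[of X] by blast
  then show ?case using 2 by (simp add: psubset_card_mono)
qed simp

declare partition_min.simps [simp del]

lemma partition_min_empty [simp]: "partition_min h {} = 0"
  by (simp add: partition_min.simps)

lemma partition_min_nonempty:
  assumes "finite X" "X \<noteq> {}"
  shows "partition_min h X = (INF Q\<in>Pow (X - {Max X}). h (X - Q) + partition_min h Q)"
  using assms by (subst partition_min.simps) simp

lemma INF_finite_attained:
  fixes f :: "'a \<Rightarrow> ennreal"
  assumes "finite S" "S \<noteq> {}"
  shows "\<exists>x\<in>S. (INF x\<in>S. f x) = f x"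
proof -
  have "Inf (f ` S) = Min (f ` S)" using assms by (intro Min_Inf[symmetric]) auto
  moreover have "Min (f ` S) \<in> f ` S" using assms by (intro Min_in) auto
  ultimately show ?thesis by auto
qed

text \<open>The recursion fixes which block comes first, so putting \<open>P\<close> in front is
  immediate only if \<open>P\<close> holds the maximum. Otherwise the first block
  \<open>Q - R\<close> of an optimal partition of \<open>Q\<close> also comes first for the union,
  and \<open>P\<close> is inserted into the smaller remainder \<open>R\<close> by induction.\<close>

lemma partition_min_Un_le:
  assumes "finite P" "finite Q" "P \<inter> Q = {}"
  shows "partition_min h (P \<union> Q) \<le> h P + partition_min h Q"
  using assms
proof (induction "card Q" arbitrary: Q rule: less_induct)
  case less
  show ?case
  proof (cases "P = {}")
    case False
    let ?m = "Max (P \<union> Q)"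
    have m: "?m \<in> P \<union> Q" using less.prems False by (intro Max_in) auto
    show ?thesis
    proof (cases "?m \<in> P")
      case True
      have "partition_min h (P \<union> Q) \<le> h (P \<union> Q - Q) + partition_min h Q"
        using less.prems True False by (subst partition_min_nonempty) (auto intro!: INF_lower)
      also have "P \<union> Q - Q = P" using less.prems by auto
      finally show ?thesis .
    next
      case mP: False
      with m have mQ: "?m \<in> Q" by auto
      then have "Max Q = ?m" using less.prems by (intro Max_eqI) auto
      moreover have "\<exists>R\<in>Pow (Q - {Max Q}). partition_min h Q = h (Q - R) + partition_min h R"
        using less.prems mQ by (subst partition_min_nonempty) (auto intro!: INF_finite_attained)
      ultimately obtain R where R: "R \<subseteq> Q - {?m}"
        and eq: "partition_min h Q = h (Q - R) + partition_min h R" by auto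
      have fR: "finite R" using R less.prems finite_subset by blast
      have "R \<subset> Q" using R mQ by auto
      then have "card R < card Q" using less.prems by (intro psubset_card_mono)
      moreover have "P \<inter> R = {}" using R less.prems by auto
      ultimately have IH: "partition_min h (P \<union> R) \<le> h P + partition_min h R"
        using less.prems fR by (intro less.hyps) auto
      have "partition_min h (P \<union> Q) \<le> h (P \<union> Q - (P \<union> R)) + partition_min h (P \<union> R)"
        using less.prems R mP False by (subst partition_min_nonempty) (auto intro!: INF_lower)
      also have "P \<union> Q - (P \<union> R) = Q - R" using less.prems by auto
      also have "h (Q - R) + partition_min h (P \<union> R) \<le> h (Q - R) + (h P + partition_min h R)"
        using IH by (rule add_left_mono)
      finally show ?thesis by (simp add: eq ac_simps)
    qed
  qed simp
qed

text \<open>The shape needed at a tree vertex: one block for each child, and a rest \<open>Z\<close>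
  for the terminals at the vertex itself.\<close>

lemma partition_min_UN_le:
  assumes "finite C" "finite Z" "\<And>c. c \<in> C \<Longrightarrow> finite (S c)"
    "\<And>c c'. c \<in> C \<Longrightarrow> c' \<in> C \<Longrightarrow> c \<noteq> c' \<Longrightarrow> S c \<inter> S c' = {}"
    "\<And>c. c \<in> C \<Longrightarrow> S c \<inter> Z = {}"
  shows "partition_min h ((\<Union>c\<in>C. S c) \<union> Z) \<le> (\<Sum>c\<in>C. h (S c)) + partition_min h Z"
  using assms
proof (induction C rule: finite_induct)
  case (insert c C)
  have "partition_min h (S c \<union> ((\<Union>c\<in>C. S c) \<union> Z)) \<le> h (S c) + partition_min h ((\<Union>c\<in>C. S c) \<union> Z)"
    using insert.hyps insert.prems by (intro partition_min_Un_le) (auto, blast+)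
  also have "partition_min h ((\<Union>c\<in>C. S c) \<union> Z) \<le> (\<Sum>c\<in>C. h (S c)) + partition_min h Z"
    using insert.prems by (intro insert.IH) auto
  finally show ?case using insert.hyps by (simp add: Un_assoc ac_simps add_left_mono)
qed simp

text \<open>Witnessed by the partition into singletons.\<close>

lemma partition_min_zero:
  assumes "finite Z" "\<And>j. j \<in> Z \<Longrightarrow> h {j} = 0"
  shows "partition_min h Z = 0"
  using assms
proof (induction Z rule: finite_induct)
  case (insert j Z)
  have "partition_min h ({j} \<union> Z) \<le> h {j} + partition_min h Z"
    using insert by (intro partition_min_Un_le) auto
  then show ?case using insert by simp
qed simp

text \<open>
  The cost of serving \<open>\<tau> ` X\<close> by one branch at \<open>v\<close>; the loop \<open>u = v\<close> is allowed, so such a branch need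
  not leave \<open>v\<close> by a single arc.
\<close>

fun branch_opt ::
    "'v set \<Rightarrow> ('v \<Rightarrow> 'v \<Rightarrow> ennreal) \<Rightarrow> (nat \<Rightarrow> 'v) \<Rightarrow> nat \<Rightarrow> 'v \<Rightarrow> nat set \<Rightarrow> ennreal" where
  "branch_opt V E \<tau> 0 v X = (if \<exists>j. X = {j} \<and> \<tau> j = v then 0 else \<infinity>)"
| "branch_opt V E \<tau> (Suc d) v X = (INF u\<in>V. E v u + partition_min (branch_opt V E \<tau> d u) X)"

section \<open>Arc sets as witnesses for the values of the recurrence\<close>

definition arcs_within :: "'v set \<Rightarrow> ('v \<Rightarrow> 'v \<Rightarrow> ennreal) \<Rightarrow> ('v \<times> 'v) set \<Rightarrow> bool" where
  "arcs_within V E A \<longleftrightarrow> finite A \<and> A \<subseteq> V \<times> V \<and> (\<forall>(u, v)\<in>A. E u v \<noteq> \<infinity>)"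

definition reach_within :: "('v \<times> 'v) set \<Rightarrow> nat \<Rightarrow> 'v \<Rightarrow> 'v \<Rightarrow> bool" where
  "reach_within A d u v \<longleftrightarrow> (\<exists>m\<le>d. (u, v) \<in> A ^^ m)"

lemma relpow_mono:
  fixes A :: "('v \<times> 'v) set"
  shows "(u, v) \<in> A ^^ m \<Longrightarrow> A \<subseteq> B \<Longrightarrow> (u, v) \<in> B ^^ m"
  by (induction m arbitrary: v) auto

lemma reach_within_mono: "reach_within A d u v \<Longrightarrow> A \<subseteq> B \<Longrightarrow> reach_within B d u v"
  unfolding reach_within_def by (meson relpow_mono)

lemma reach_within_Suc:
  assumes "(u, v) \<in> A" "reach_within A d v w"
  shows "reach_within A (Suc d) u w"
  using assms unfolding reach_within_def by (metis Suc_le_mono relpow_Suc_I2)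

lemma sum_Un_le_ennreal:
  fixes f :: "'a \<Rightarrow> ennreal"
  assumes "finite A" "finite B"
  shows "sum f (A \<union> B) \<le> sum f A + sum f B"
proof -
  have "sum f (A \<union> B) = sum f A + sum f (B - A)"
    using assms by (metis Diff_disjoint Un_Diff_cancel finite_Diff sum.union_disjoint)
  also have "sum f (B - A) \<le> sum f B" using assms by (intro sum_mono2) auto
  finally show ?thesis by (simp add: add_left_mono)
qed

text \<open>Unlike trees, such arc sets can be united without any disjointness. The weight is only
  bounded by \<open>w\<close>, because arcs shared by two sets are counted once in the
  union.\<close>

definition arcs_reach ::
    "'v set \<Rightarrow> ('v \<Rightarrow> 'v \<Rightarrow> ennreal) \<Rightarrow> (nat \<Rightarrow> 'v) \<Rightarrow> nat \<Rightarrow> 'v \<Rightarrow> nat set \<Rightarrow> ennreal \<Rightarrow> bool" where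
  "arcs_reach V E \<tau> d v X w \<longleftrightarrow> (\<exists>A. arcs_within V E A \<and> (\<forall>j\<in>X. reach_within A d v (\<tau> j)) \<and>
     (\<Sum>(i, j)\<in>A. E i j) \<le> w)"

lemma arcs_reach_Un:
  assumes "arcs_reach V E \<tau> d v X w" "arcs_reach V E \<tau> d v Y w'"
  shows "arcs_reach V E \<tau> d v (X \<union> Y) (w + w')"
proof -
  from assms obtain A B where AB: "arcs_within V E A" "arcs_within V E B"
    "\<forall>j\<in>X. reach_within A d v (\<tau> j)" "\<forall>j\<in>Y. reach_within B d v (\<tau> j)"
    "(\<Sum>(i, j)\<in>A. E i j) \<le> w" "(\<Sum>(i, j)\<in>B. E i j) \<le> w'"
    unfolding arcs_reach_def by auto
  have "(\<Sum>(i, j)\<in>A \<union> B. E i j) \<le> w + w'"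
    using sum_Un_le_ennreal[of A B "\<lambda>(i, j). E i j"] AB(1,2) add_mono[OF AB(5,6)]
    unfolding arcs_within_def by (meson order_trans)
  moreover have "arcs_within V E (A \<union> B)" using AB(1,2) unfolding arcs_within_def by auto
  moreover have "\<forall>j\<in>X \<union> Y. reach_within (A \<union> B) d v (\<tau> j)"
    using AB(3,4) by (auto intro: reach_within_mono)
  ultimately show ?thesis unfolding arcs_reach_def by blast
qed

lemma arcs_reach_empty: "arcs_reach V E \<tau> d v {} w"
  unfolding arcs_reach_def arcs_within_def by (intro exI[of _ "{}"]) auto

text \<open>Unfolding the attained minima yields a partition of \<open>X\<close>, and the arc sets
  of its blocks are united. A finite sum has finite summands, so the assumption on \<open>h\<close>
  applies to every block.\<close>

lemma partition_min_sound:
  assumes "\<And>Y. finite Y \<Longrightarrow> h Y \<noteq> \<infinity> \<Longrightarrow> arcs_reach V E \<tau> d v Y (h Y)"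
    and "finite X" "partition_min h X \<noteq> \<infinity>"
  shows "arcs_reach V E \<tau> d v X (partition_min h X)"
  using assms(2,3)
proof (induction "card X" arbitrary: X rule: less_induct)
  case less
  show ?case
  proof (cases "X = {}")
    case False
    have "\<exists>Q\<in>Pow (X - {Max X}). partition_min h X = h (X - Q) + partition_min h Q"
      using less.prems False by (subst partition_min_nonempty) (auto intro!: INF_finite_attained)
    then obtain Q where Q: "Q \<subseteq> X - {Max X}"
      and eq: "partition_min h X = h (X - Q) + partition_min h Q" by auto
    have "Q \<subset> X" using Q Max_in[of X] less.prems False by blast
    then have "card Q < card X" "finite Q"
      using less.prems by (auto simp: psubset_card_mono finite_subset)
    moreover have ne: "h (X - Q) \<noteq> \<infinity>" "partition_min h Q \<noteq> \<infinity>" using eq less.prems by auto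
    ultimately have "arcs_reach V E \<tau> d v Q (partition_min h Q)" by (intro less.hyps)
    from arcs_reach_Un[OF assms(1)[OF _ ne(1)] this] have
      "arcs_reach V E \<tau> d v (X - Q \<union> Q) (h (X - Q) + partition_min h Q)" using less.prems by simp
    moreover have "X - Q \<union> Q = X" using Q by auto
    ultimately show ?thesis by (simp add: eq)
  qed (simp add: arcs_reach_empty)
qed

text \<open>The arc \<open>(v, u)\<close> is put in front of the arc set found at \<open>u\<close>.
  It may be a loop; since reachability counts the steps of walks, this needs no separate
  treatment.\<close>

lemma branch_opt_sound:
  assumes "finite V" "v \<in> V" "finite X" "branch_opt V E \<tau> d v X \<noteq> \<infinity>"
  shows "arcs_reach V E \<tau> d v X (branch_opt V E \<tau> d v X)"
  using assms(2-)
proof (induction d arbitrary: v X)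
  case 0
  then obtain j where "X = {j}" "\<tau> j = v" by (auto split: if_splits)
  then show ?case unfolding arcs_reach_def arcs_within_def reach_within_def
    by (intro exI[of _ "{}"]) auto
next
  case (Suc d)
  obtain u where u: "u \<in> V"
    and eq: "branch_opt V E \<tau> (Suc d) v X = E v u + partition_min (branch_opt V E \<tau> d u) X"
    using INF_finite_attained[OF assms(1), of "\<lambda>u. E v u + partition_min (branch_opt V E \<tau> d u) X"]
      Suc.prems(1) by auto
  have ne: "E v u \<noteq> \<infinity>" "partition_min (branch_opt V E \<tau> d u) X \<noteq> \<infinity>"
    using eq Suc.prems by auto
  have "arcs_reach V E \<tau> d u X (partition_min (branch_opt V E \<tau> d u) X)"
    using Suc.IH u ne Suc.prems by (intro partition_min_sound) auto
  then obtain A where A: "arcs_within V E A" "\<forall>j\<in>X. reach_within A d u (\<tau> j)"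
    "(\<Sum>(i, j)\<in>A. E i j) \<le> partition_min (branch_opt V E \<tau> d u) X"
    unfolding arcs_reach_def by auto
  have "arcs_within V E (insert (v, u) A)" using A(1) u ne Suc.prems by (auto simp: arcs_within_def)
  moreover have "\<forall>j\<in>X. reach_within (insert (v, u) A) (Suc d) v (\<tau> j)"
    using A(2) by (auto intro!: reach_within_Suc[of _ u] intro: reach_within_mono)
  moreover have "(\<Sum>(i, j)\<in>insert (v, u) A. E i j) \<le> branch_opt V E \<tau> (Suc d) v X"
  proof -
    have "(\<Sum>(i, j)\<in>insert (v, u) A. E i j) \<le> E v u + (\<Sum>(i, j)\<in>A. E i j)"
      using sum_Un_le_ennreal[of "{(v, u)}" A "\<lambda>(i, j). E i j"] A(1) by (simp add: arcs_within_def)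
    also have "\<dots> \<le> branch_opt V E \<tau> (Suc d) v X" unfolding eq using A(3) by (rule add_left_mono)
    finally show ?thesis .
  qed
  ultimately show ?case unfolding arcs_reach_def by blast
qed

section \<open>Trees given by parent and depth functions\<close>

text \<open>Recording depths makes acyclicity automatic and supplies a measure for inductions along
  the tree.\<close>

definition parent_tree :: "'v set \<Rightarrow> 'v \<Rightarrow> ('v \<Rightarrow> 'v) \<Rightarrow> ('v \<Rightarrow> nat) \<Rightarrow> bool" where
  "parent_tree U r \<pi> \<delta> \<longleftrightarrow> finite U \<and> r \<in> U \<and> \<delta> r = 0 \<and>
     (\<forall>x\<in>U - {r}. \<pi> x \<in> U \<and> \<delta> x = Suc (\<delta> (\<pi> x)))"

text \<open>Fixing the number of steps to the depth difference keeps the climb from going past the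
  root, where \<open>\<pi>\<close> is arbitrary.\<close>

definition descendants :: "'v set \<Rightarrow> ('v \<Rightarrow> 'v) \<Rightarrow> ('v \<Rightarrow> nat) \<Rightarrow> 'v \<Rightarrow> 'v set" where
  "descendants U \<pi> \<delta> v = {x \<in> U. \<delta> v \<le> \<delta> x \<and> (\<pi> ^^ (\<delta> x - \<delta> v)) x = v}"

lemma parent_tree_ancestor:
  assumes "parent_tree U r \<pi> \<delta>" "x \<in> U" "i \<le> \<delta> x"
  shows "(\<pi> ^^ i) x \<in> U \<and> \<delta> ((\<pi> ^^ i) x) = \<delta> x - i"
  using assms(3)
proof (induction i)
  case (Suc i)
  then have *: "(\<pi> ^^ i) x \<in> U" "\<delta> ((\<pi> ^^ i) x) = \<delta> x - i" "\<delta> x - i \<noteq> 0" by auto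
  then have "(\<pi> ^^ i) x \<noteq> r" using assms(1) unfolding parent_tree_def by metis
  then show ?case using assms(1) * unfolding parent_tree_def by auto
qed (use assms in auto)

text \<open>The ancestors of \<open>x\<close> realise all depths from \<open>0\<close> to
  \<open>\<delta> x\<close>, hence are that many distinct vertices. This is what justifies cutting
  the depth bound at the number of vertices.\<close>

lemma parent_tree_depth_less_card:
  assumes "parent_tree U r \<pi> \<delta>" "x \<in> U"
  shows "\<delta> x < card U"
proof -
  have fin: "finite U" using assms by (simp add: parent_tree_def)
  have "{..\<delta> x} \<subseteq> \<delta> ` U"
  proof
    fix i assume "i \<in> {..\<delta> x}"
    then have "\<delta> ((\<pi> ^^ (\<delta> x - i)) x) = i" "(\<pi> ^^ (\<delta> x - i)) x \<in> U"
      using parent_tree_ancestor[OF assms, of "\<delta> x - i"] by auto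
    then show "i \<in> \<delta> ` U" by force
  qed
  then have "Suc (\<delta> x) \<le> card (\<delta> ` U)" using fin card_mono[of "\<delta> ` U" "{..\<delta> x}"] by simp
  also have "\<dots> \<le> card U" using fin by (rule card_image_le)
  finally show ?thesis by simp
qed

definition children :: "'v set \<Rightarrow> 'v \<Rightarrow> ('v \<Rightarrow> 'v) \<Rightarrow> 'v \<Rightarrow> 'v set" where
  "children U r \<pi> v = {c \<in> U - {r}. \<pi> c = v}"

text \<open>The last vertex before \<open>v\<close> on the climb from \<open>x\<close> is the child
  whose subtree contains \<open>x\<close>. Siblings have equal depth, so the climb from
  \<open>x\<close> passes at most one of them.\<close>

lemma descendants_children:
  assumes T: "parent_tree U r \<pi> \<delta>" and v: "v \<in> U"
  shows "descendants U \<pi> \<delta> v = insert v (\<Union>c\<in>children U r \<pi> v. descendants U \<pi> \<delta> c)"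
    and "v \<notin> (\<Union>c\<in>children U r \<pi> v. descendants U \<pi> \<delta> c)"
    and "c \<in> children U r \<pi> v \<Longrightarrow> c' \<in> children U r \<pi> v \<Longrightarrow> c \<noteq> c' \<Longrightarrow>
      descendants U \<pi> \<delta> c \<inter> descendants U \<pi> \<delta> c' = {}"
proof -
  have "\<delta> r = 0" using T by (simp add: parent_tree_def)
  have ch: "c \<in> U" "c \<noteq> r" "\<delta> c = Suc (\<delta> v)" "\<pi> c = v" if "c \<in> children U r \<pi> v" for c
    using that T unfolding children_def parent_tree_def by auto
  show "v \<notin> (\<Union>c\<in>children U r \<pi> v. descendants U \<pi> \<delta> c)"
    using ch by (fastforce simp: descendants_def)
  show "descendants U \<pi> \<delta> c \<inter> descendants U \<pi> \<delta> c' = {}"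
    if "c \<in> children U r \<pi> v" "c' \<in> children U r \<pi> v" "c \<noteq> c'"
    using ch(3)[OF that(1)] ch(3)[OF that(2)] that(3) by (auto simp: descendants_def)
  show "descendants U \<pi> \<delta> v = insert v (\<Union>c\<in>children U r \<pi> v. descendants U \<pi> \<delta> c)"
  proof (intro equalityI subsetI)
    fix x assume x: "x \<in> descendants U \<pi> \<delta> v"
    show "x \<in> insert v (\<Union>c\<in>children U r \<pi> v. descendants U \<pi> \<delta> c)"
    proof (cases "\<delta> x = \<delta> v")
      case False
      \<comment> \<open>The number of steps from \<open>x\<close> up to the child of
        \<open>v\<close>, one less than up to \<open>v\<close>.\<close>
      define i where "i = \<delta> x - \<delta> v - 1"
      have i: "\<delta> x - \<delta> v = Suc i" "i \<le> \<delta> x" using False x by (auto simp: i_def descendants_def)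
      let ?c = "(\<pi> ^^ i) x"
      have "?c \<in> U" "\<delta> ?c = \<delta> x - i" using parent_tree_ancestor[OF T _ i(2)] x
        by (auto simp: descendants_def)
      moreover have "\<pi> ?c = v" using x i by (auto simp: descendants_def)
      moreover have "?c \<noteq> r" using \<open>\<delta> ?c = \<delta> x - i\<close> i \<open>\<delta> r = 0\<close> by auto
      ultimately have "?c \<in> children U r \<pi> v" by (simp add: children_def)
      moreover have "x \<in> descendants U \<pi> \<delta> ?c" using x i \<open>\<delta> ?c = \<delta> x - i\<close>
        by (auto simp: descendants_def)
      ultimately show ?thesis by blast
    qed (use x in \<open>auto simp: descendants_def\<close>)
  next
    fix x assume "x \<in> insert v (\<Union>c\<in>children U r \<pi> v. descendants U \<pi> \<delta> c)"
    then consider "x = v" | c where "c \<in> children U r \<pi> v" "x \<in> descendants U \<pi> \<delta> c" by auto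
    then show "x \<in> descendants U \<pi> \<delta> v"
    proof cases
      case 2
      have eq: "\<delta> x - \<delta> v = Suc (\<delta> x - \<delta> c)" using ch[OF 2(1)] 2(2) by (auto simp: descendants_def)
      show ?thesis using ch[OF 2(1)] 2(2) unfolding descendants_def mem_Collect_eq eq by auto
    qed (use v in \<open>simp add: descendants_def\<close>)
  qed
qed

text \<open>The terminals below \<open>v\<close> are partitioned by the child whose subtree contains
  them, with those at \<open>v\<close> itself as singletons; this is one of the partitions minimised
  over. The induction is on the remaining depth \<open>D - \<delta> v\<close> instead of the height
  of the subtree, so that each tree arc consumes exactly one level of the recurrence.\<close>

lemma branch_opt_le_tree:
  assumes T: "parent_tree U r \<pi> \<delta>" and depth: "\<And>x. x \<in> U \<Longrightarrow> \<delta> x \<le> D"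
    and U: "U \<subseteq> V" and E: "\<And>v. v \<in> V \<Longrightarrow> E v v = 0" and v: "v \<in> U"
  shows "partition_min (branch_opt V E \<tau> (D - \<delta> v) v) {j. j < k \<and> \<tau> j \<in> descendants U \<pi> \<delta> v}
    \<le> (\<Sum>x\<in>descendants U \<pi> \<delta> v - {v}. E (\<pi> x) x)"
  using v
proof (induction "D - \<delta> v" arbitrary: v rule: less_induct)
  case less
  let ?C = "children U r \<pi> v" and ?S = "\<lambda>c. {j. j < k \<and> \<tau> j \<in> descendants U \<pi> \<delta> c}"
  let ?Z = "{j. j < k \<and> \<tau> j = v}" and ?h = "branch_opt V E \<tau> (D - \<delta> v) v"
  note dc = descendants_children[OF T less.prems]
  have fU: "finite U" using T by (simp add: parent_tree_def)
  then have fC: "finite ?C" by (simp add: children_def)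
  have fd: "finite (descendants U \<pi> \<delta> c)" for c using fU by (simp add: descendants_def)
  \<comment> \<open>The loop at \<open>v\<close> is taken \<open>d\<close> times at no cost until
    the base case applies.\<close>
  have single: "branch_opt V E \<tau> d v {j} = 0" if "\<tau> j = v" for d j
  proof (induction d)
    case (Suc d)
    have "branch_opt V E \<tau> (Suc d) v {j} \<le> E v v + partition_min (branch_opt V E \<tau> d v) {j}"
      using less.prems U by (auto intro!: INF_lower)
    also have "\<dots> = 0" using E[of v] less.prems U Suc by (subst partition_min_zero) auto
    finally show ?case by simp
  qed (use that in auto)
  have "?S v = (\<Union>c\<in>?C. ?S c) \<union> ?Z" by (subst dc(1)) auto
  then have "partition_min ?h (?S v) \<le> (\<Sum>c\<in>?C. ?h (?S c)) + partition_min ?h ?Z"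
    using dc(2) fC by (auto intro!: partition_min_UN_le dest: dc(3))
  also have "partition_min ?h ?Z = 0" using single by (intro partition_min_zero) auto
  also have "(\<Sum>c\<in>?C. ?h (?S c)) \<le> (\<Sum>c\<in>?C. \<Sum>x\<in>descendants U \<pi> \<delta> c. E (\<pi> x) x)"
  proof (intro sum_mono)
    fix c assume c: "c \<in> ?C"
    then have cU: "c \<in> U" "\<delta> c = Suc (\<delta> v)" "\<pi> c = v" "\<delta> c \<le> D"
      using T depth[of c] unfolding children_def parent_tree_def by auto
    \<comment> \<open>A child exists, so the depth allowance at \<open>v\<close> is not exhausted
      and \<open>branch_opt\<close> can be unfolded once.\<close>
    then have eq: "D - \<delta> v = Suc (D - \<delta> c)" by auto
    have "?h (?S c) \<le> E v c + partition_min (branch_opt V E \<tau> (D - \<delta> c) c) (?S c)"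
      unfolding eq using cU U by (auto intro!: INF_lower)
    also have "\<dots> \<le> E v c + (\<Sum>x\<in>descendants U \<pi> \<delta> c - {c}. E (\<pi> x) x)"
      using cU eq by (intro add_left_mono less.hyps) auto
    also have "\<dots> = (\<Sum>x\<in>descendants U \<pi> \<delta> c. E (\<pi> x) x)"
      using cU(1,3) fd[of c] sum.remove[of "descendants U \<pi> \<delta> c" c "\<lambda>x. E (\<pi> x) x"]
      by (simp add: descendants_def)
    finally show "?h (?S c) \<le> \<dots>" .
  qed
  also have "\<dots> = (\<Sum>x\<in>(\<Union>c\<in>?C. descendants U \<pi> \<delta> c). E (\<pi> x) x)"
    using dc(3) fC fd by (subst sum.UNION_disjoint) auto
  also have "(\<Union>c\<in>?C. descendants U \<pi> \<delta> c) = descendants U \<pi> \<delta> v - {v}" using dc(1,2) by auto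
  finally show ?case by simp
qed

section \<open>Rooted trees as digraphs and as parent functions\<close>

lemma awalk_conv_pcas:
  "pre_digraph.awalk (with_proj H) u p v \<longleftrightarrow> u \<in> pverts H \<and> set p \<subseteq> parcs H \<and> pcas u p v"
  by (simp add: pre_digraph.awalk_def cas_with_proj_eq)

lemma pcas_snoc: "pcas u (p @ [a]) v \<longleftrightarrow> pcas u p (fst a) \<and> snd a = v"
  by (induction p arbitrary: u) auto

lemma awalk_snoc:
  "pre_digraph.awalk (with_proj H) u (p @ [a]) v \<longleftrightarrow>
     pre_digraph.awalk (with_proj H) u p (fst a) \<and> a \<in> parcs H \<and> snd a = v"
  by (auto simp: awalk_conv_pcas pcas_snoc)

lemma wf_pair_digraph_iff: "wf_digraph (with_proj H) \<longleftrightarrow> parcs H \<subseteq> pverts H \<times> pverts H"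
  by (auto simp: wf_digraph_def subset_iff)

lemma subgraph_of_iff:
  "subgraph (with_proj H) (with_proj (graph_of V E)) \<longleftrightarrow>
     pverts H \<subseteq> V \<and> parcs H \<subseteq> pverts H \<times> pverts H \<and> (\<forall>(i, j)\<in>parcs H. E i j \<noteq> \<infinity>)"
  unfolding subgraph_def wf_pair_digraph_iff compatible_def by (auto simp: graph_of_def)

definition parent_arcs :: "'v set \<Rightarrow> 'v \<Rightarrow> ('v \<Rightarrow> 'v) \<Rightarrow> ('v \<times> 'v) set" where
  "parent_arcs U r \<pi> = (\<lambda>x. (\<pi> x, x)) ` (U - {r})"

lemma sum_parent_arcs:
  "(\<Sum>(i, j)\<in>parent_arcs U r \<pi>. f i j) = (\<Sum>x\<in>U - {r}. f (\<pi> x) x)"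
  unfolding parent_arcs_def by (subst sum.reindex) (auto simp: inj_on_def)

text \<open>A vertex of maximal depth has no child, as a child would be deeper. Hence a diameter
  measured at leaves only controls the depth of all vertices.\<close>

lemma leaves_parent_tree:
  assumes T: "parent_tree U r \<pi> \<delta>"
    and H: "pverts H = U" "parcs H = parent_arcs U r \<pi>"
  shows "\<exists>y\<in>leaves H. \<forall>x\<in>U. \<delta> x \<le> \<delta> y"
proof -
  have fin: "finite U" "U \<noteq> {}" using T by (auto simp: parent_tree_def)
  then have "Max (\<delta> ` U) \<in> \<delta> ` U" by (intro Max_in) auto
  then obtain y where y: "y \<in> U" "\<delta> y = Max (\<delta> ` U)" by force
  have max: "\<forall>x\<in>U. \<delta> x \<le> \<delta> y" using fin y by simp
  have "y \<in> leaves H"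
  proof (rule ccontr)
    assume "y \<notin> leaves H"
    then obtain x where "x \<in> U - {r}" "\<pi> x = y"
      using y H by (auto simp: leaves_def out_arcs_def parent_arcs_def)
    then show False using max T unfolding parent_tree_def by force
  qed
  then show ?thesis using max by blast
qed

lemma tree_diameter_parent_tree:
  assumes T: "parent_tree U r \<pi> \<delta>"
    and H: "pverts H = U" "parcs H = parent_arcs U r \<pi>"
    and walks: "\<And>p x. pre_digraph.awalk (with_proj H) r p x \<Longrightarrow> length p = \<delta> x"
    and ex: "\<And>x. x \<in> U \<Longrightarrow> \<exists>p. pre_digraph.awalk (with_proj H) r p x"
  shows "tree_diameter H r \<le> D \<longleftrightarrow> (\<forall>x\<in>U. \<delta> x \<le> D)"
proof -
  have "leaves H \<subseteq> U" using H by (auto simp: leaves_def)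
  then have "finite (\<delta> ` leaves H)" using T by (auto simp: parent_tree_def intro: finite_subset)
  moreover have "{length p | p v. v \<in> leaves H \<and> pre_digraph.awalk (with_proj H) r p v} = \<delta> ` leaves H"
  proof (intro equalityI subsetI)
    fix l assume "l \<in> \<delta> ` leaves H"
    then obtain v where v: "v \<in> leaves H" "l = \<delta> v" by blast
    then obtain p where p: "pre_digraph.awalk (with_proj H) r p v" using ex \<open>leaves H \<subseteq> U\<close> by blast
    then have "l = length p" using v walks by simp
    then show "l \<in> {length p | p v. v \<in> leaves H \<and> pre_digraph.awalk (with_proj H) r p v}"
      using v p by blast
  qed (use walks in blast)
  ultimately show ?thesis
    using leaves_parent_tree[OF T H] \<open>leaves H \<subseteq> U\<close> unfolding tree_diameter_def
    by (subst Max_le_iff) (auto intro: order_trans)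
qed

lemma parent_tree_walk_length:
  assumes T: "parent_tree U r \<pi> \<delta>"
    and H: "pverts H = U" "parcs H = parent_arcs U r \<pi>"
    and "pre_digraph.awalk (with_proj H) r p x"
  shows "length p = \<delta> x"
  using assms(4)
proof (induction p arbitrary: x rule: rev_induct)
  case (snoc a p)
  then show ?case using T H by (auto simp: awalk_snoc parent_arcs_def parent_tree_def)
qed (use T in \<open>auto simp: awalk_conv_pcas parent_tree_def\<close>)

text \<open>The only arc into \<open>x\<close> is \<open>(\<pi> x, x)\<close>, so two walks agree
  from the end backwards; having the same length, they are exhausted together.\<close>

lemma parent_tree_walk_unique:
  assumes T: "parent_tree U r \<pi> \<delta>"
    and H: "pverts H = U" "parcs H = parent_arcs U r \<pi>"
    and "pre_digraph.awalk (with_proj H) r p x" "pre_digraph.awalk (with_proj H) r q x"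
  shows "p = q"
  using assms(4,5)
proof (induction p arbitrary: x q rule: rev_induct)
  case Nil
  then show ?case using parent_tree_walk_length[OF T H] by (metis length_0_conv list.size(3))
next
  case (snoc a p)
  have "length (p @ [a]) = length q" using parent_tree_walk_length[OF T H] snoc.prems by metis
  then obtain b q' where q: "q = q' @ [b]" by (cases q rule: rev_cases) auto
  then have "a = b" using snoc.prems H by (auto simp: awalk_snoc parent_arcs_def)
  then show ?case using snoc.IH snoc.prems by (auto simp: q awalk_snoc)
qed

lemma parent_tree_walk_exists:
  assumes T: "parent_tree U r \<pi> \<delta>"
    and H: "pverts H = U" "parcs H = parent_arcs U r \<pi>" and "x \<in> U"
  shows "\<exists>p. pre_digraph.awalk (with_proj H) r p x"
  using assms(4)
proof (induction "\<delta> x" arbitrary: x rule: less_induct)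
  case less
  show ?case
  proof (cases "x = r")
    case True
    then show ?thesis using T H by (intro exI[of _ "[]"]) (simp add: awalk_conv_pcas parent_tree_def)
  next
    case False
    then have "\<pi> x \<in> U" "\<delta> (\<pi> x) < \<delta> x" "(\<pi> x, x) \<in> parcs H"
      using T less.prems H by (auto simp: parent_tree_def parent_arcs_def)
    with less.hyps obtain p where "pre_digraph.awalk (with_proj H) r p (\<pi> x)" by blast
    then have "pre_digraph.awalk (with_proj H) r (p @ [(\<pi> x, x)]) x"
      using \<open>(\<pi> x, x) \<in> parcs H\<close> by (simp add: awalk_snoc)
    then show ?thesis by blast
  qed
qed

lemma feasible_tree_of_parent_tree:
  assumes T: "parent_tree U r \<pi> \<delta>" and "\<forall>x\<in>U. \<delta> x \<le> D" "U \<subseteq> V" "S \<subseteq> U"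
    and "\<forall>x\<in>U - {r}. E (\<pi> x) x \<noteq> \<infinity>"
  shows "feasible_tree V E S r D \<lparr>pverts = U, parcs = parent_arcs U r \<pi>\<rparr>"
proof -
  let ?H = "\<lparr>pverts = U, parcs = parent_arcs U r \<pi>\<rparr>"
  have H: "pverts ?H = U" "parcs ?H = parent_arcs U r \<pi>" by auto
  have sub: "parent_arcs U r \<pi> \<subseteq> U \<times> U" using T by (auto simp: parent_arcs_def parent_tree_def)
  then have "subgraph (with_proj ?H) (with_proj (graph_of V E))"
    using assms unfolding subgraph_of_iff by (auto simp: parent_arcs_def)
  moreover have "rooted_tree ?H r"
    using T sub parent_tree_walk_exists[OF T H] parent_tree_walk_unique[OF T H]
    unfolding rooted_tree_def wf_pair_digraph_iff by (auto simp: parent_tree_def)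
  moreover have "tree_diameter ?H r \<le> D"
    using tree_diameter_parent_tree[OF T H, of D] parent_tree_walk_length[OF T H]
      parent_tree_walk_exists[OF T H] assms(2) by blast
  ultimately show ?thesis using assms unfolding feasible_tree_def by auto
qed

text \<open>The depth of \<open>x\<close> is the length of its unique walk from the root, and the
  parent is the tail of the last arc of that walk.\<close>

lemma parent_tree_of_feasible_tree:
  assumes "feasible_tree V E S r D H" "finite V"
  shows "\<exists>\<pi> \<delta>. parent_tree (pverts H) r \<pi> \<delta> \<and> (\<forall>x\<in>pverts H. \<delta> x \<le> D) \<and>
    parcs H = parent_arcs (pverts H) r \<pi>"
proof -
  let ?U = "pverts H" and ?walk = "\<lambda>p x. pre_digraph.awalk (with_proj H) r p x"
  from assms have sub: "?U \<subseteq> V" "parcs H \<subseteq> ?U \<times> ?U" and r: "r \<in> ?U"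
    and uniq: "\<And>x. x \<in> ?U \<Longrightarrow> \<exists>!p. ?walk p x" and diam: "tree_diameter H r \<le> D"
    unfolding feasible_tree_def subgraph_of_iff rooted_tree_def by auto
  define w where "w = (\<lambda>x. THE p. ?walk p x)"
  have w: "?walk (w x) x" if "x \<in> ?U" for x using theI'[OF uniq[OF that]] by (simp add: w_def)
  have in_U: "x \<in> ?U" if "?walk p x" for p x
    using that sub r by (cases p rule: rev_cases) (auto simp: awalk_snoc, auto simp: awalk_conv_pcas)
  have w_eq: "w x = p" if "?walk p x" for x p using uniq[OF in_U[OF that]] w[OF in_U[OF that]] that by blast
  define \<pi> where "\<pi> = (\<lambda>x. fst (last (w x)))"
  define \<delta> where "\<delta> = (\<lambda>x. length (w x))"
  have w_r: "w r = []" using r by (intro w_eq) (simp add: awalk_conv_pcas)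
  \<comment> \<open>Extending the walk to \<open>y\<close> by \<open>(y, x)\<close> must give the
    unique walk to \<open>x\<close>. So every arc is a parent arc, and none enters \<open>r\<close>,
    whose walk is empty.\<close>
  have step: "\<pi> x = y \<and> \<delta> x = Suc (\<delta> y) \<and> x \<noteq> r" if "(y, x) \<in> parcs H" for x y
  proof -
    have "w x = w y @ [(y, x)]" using w[of y] that sub by (intro w_eq) (auto simp: awalk_snoc)
    then show ?thesis using w_r by (auto simp: \<pi>_def \<delta>_def)
  qed
  have parent: "(\<pi> x, x) \<in> parcs H" if x: "x \<in> ?U" "x \<noteq> r" for x
  proof -
    have "w x \<noteq> []" using w[OF x(1)] x(2) by (auto simp: awalk_conv_pcas)
    then have eq: "w x = butlast (w x) @ [last (w x)]" by simp
    have "last (w x) \<in> parcs H" "snd (last (w x)) = x"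
      using w[OF x(1)] by (subst (asm) eq, simp only: awalk_snoc)+
    then show ?thesis by (metis \<pi>_def prod.collapse)
  qed
  have "\<pi> x \<in> ?U \<and> \<delta> x = Suc (\<delta> (\<pi> x))" if "x \<in> ?U - {r}" for x
    using parent[of x] step[of "\<pi> x" x] sub that by blast
  then have T: "parent_tree ?U r \<pi> \<delta>"
    using r finite_subset[OF sub(1) assms(2)] w_r unfolding parent_tree_def
    by (simp add: \<delta>_def)
  have arcs: "parcs H = parent_arcs ?U r \<pi>"
  proof
    show "parcs H \<subseteq> parent_arcs ?U r \<pi>" 
    proof
      fix a assume "a \<in> parcs H"
      then show "a \<in> parent_arcs ?U r \<pi>"
        using step[of "fst a" "snd a"] sub by (cases a) (auto simp: parent_arcs_def)
    qed
    show "parent_arcs ?U r \<pi> \<subseteq> parcs H" using parent by (auto simp: parent_arcs_def)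
  qed
  have "\<forall>x\<in>?U. \<delta> x \<le> D"
    using tree_diameter_parent_tree[OF T refl arcs, of D] diam parent_tree_walk_length[OF T refl arcs]
      parent_tree_walk_exists[OF T refl arcs] by blast
  then show ?thesis using T arcs by blast
qed

lemma parent_tree_of_arcs:
  assumes A: "arcs_within V E A" and "finite V" "r \<in> V"
  shows "\<exists>U \<pi> \<delta>. parent_tree U r \<pi> \<delta> \<and> (\<forall>x\<in>U. \<delta> x \<le> d) \<and> U \<subseteq> V \<and>
    {x. reach_within A d r x} \<subseteq> U \<and> parent_arcs U r \<pi> \<subseteq> A"
proof -
  let ?U = "{x. reach_within A d r x}"
  define \<delta> where "\<delta> = (\<lambda>x. LEAST m. (r, x) \<in> A ^^ m)"
  have least: "(r, x) \<in> A ^^ \<delta> x \<and> \<delta> x \<le> m" if "(r, x) \<in> A ^^ m" for x m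
    unfolding \<delta>_def using LeastI[of "\<lambda>m. (r, x) \<in> A ^^ m", OF that]
      Least_le[of "\<lambda>m. (r, x) \<in> A ^^ m", OF that] by blast
  have \<delta>: "(r, x) \<in> A ^^ \<delta> x \<and> \<delta> x \<le> d" if "x \<in> ?U" for x
    using that least unfolding reach_within_def by (blast intro: order_trans)
  have \<delta>_r: "\<delta> r = 0" using least[of r 0] by simp
  have "\<exists>y. (y, x) \<in> A \<and> y \<in> ?U \<and> \<delta> x = Suc (\<delta> y)" if x: "x \<in> ?U - {r}" for x
  proof -
    have *: "(r, x) \<in> A ^^ \<delta> x" "\<delta> x \<le> d" using \<delta> x by auto
    then obtain m where m: "\<delta> x = Suc m" using x by (cases "\<delta> x") auto
    then obtain y where y: "(r, y) \<in> A ^^ m" "(y, x) \<in> A" using * by auto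
    \<comment> \<open>A shorter walk to \<open>y\<close> would shorten the one to \<open>x\<close>,
      so \<open>y\<close> lies exactly one level above \<open>x\<close>.\<close>
    have "(r, x) \<in> A ^^ Suc (\<delta> y)" using least[OF y(1)] y(2) by auto
    then have "\<delta> x = Suc (\<delta> y)" using least[OF y(1)] least[of x "Suc (\<delta> y)"] m by simp
    moreover have "y \<in> ?U" using y(1) m *(2) unfolding reach_within_def by (intro CollectI exI[of _ m]) simp
    ultimately show ?thesis using y by blast
  qed
  then obtain \<pi> where \<pi>: "\<And>x. x \<in> ?U - {r} \<Longrightarrow> (\<pi> x, x) \<in> A \<and> \<pi> x \<in> ?U \<and> \<delta> x = Suc (\<delta> (\<pi> x))"
    by metis
  have rU: "r \<in> ?U" unfolding reach_within_def by (auto intro: exI[of _ 0])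
  have UV: "?U \<subseteq> V"
  proof
    fix x assume "x \<in> ?U"
    then show "x \<in> V" using \<pi>[of x] A \<open>r \<in> V\<close> by (cases "x = r") (auto simp: arcs_within_def)
  qed
  have "parent_tree ?U r \<pi> \<delta>"
    using \<pi> rU \<delta>_r finite_subset[OF UV \<open>finite V\<close>] by (auto simp: parent_tree_def)
  moreover have "parent_arcs ?U r \<pi> \<subseteq> A" using \<pi> by (auto simp: parent_arcs_def)
  ultimately show ?thesis using UV \<delta> by blast
qed

section \<open>The recurrence computes the optimum\<close>

definition tree_opt ::
    "'v set \<Rightarrow> ('v \<Rightarrow> 'v \<Rightarrow> ennreal) \<Rightarrow> (nat \<Rightarrow> 'v) \<Rightarrow> nat \<Rightarrow> 'v \<Rightarrow> nat set \<Rightarrow> ennreal" where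
  "tree_opt V E \<tau> d v X = partition_min (branch_opt V E \<tau> d v) X"

text \<open>Depths in a tree stay below the number of vertices, so replacing \<open>D\<close> by
  \<open>min (card V) D\<close> excludes no feasible tree. At the root the subtree bound speaks of
  the whole tree.\<close>

lemma tree_opt_le_feasible:
  assumes I: "ddcst_instance V E T r D" and \<tau>: "bij_betw \<tau> {..<k} T"
    and H: "feasible_tree V E T r D H"
  shows "tree_opt V E \<tau> (min (card V) D) r {..<k} \<le> tree_weight E H"
proof -
  have V: "finite V" "\<And>v. v \<in> V \<Longrightarrow> E v v = 0" using I by (auto simp: ddcst_instance_def)
  obtain \<pi> \<delta> where T: "parent_tree (pverts H) r \<pi> \<delta>" and D: "\<forall>x\<in>pverts H. \<delta> x \<le> D"
    and arcs: "parcs H = parent_arcs (pverts H) r \<pi>"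
    using parent_tree_of_feasible_tree[OF H V(1)] by blast
  have sub: "pverts H \<subseteq> V" "T \<subseteq> pverts H"
    using H unfolding feasible_tree_def subgraph_of_iff by auto
  have r: "r \<in> pverts H" "\<delta> r = 0" using T by (auto simp: parent_tree_def)
  have depth: "\<delta> x \<le> min (card V) D" if "x \<in> pverts H" for x
    using parent_tree_depth_less_card[OF T that] card_mono[OF V(1) sub(1)] D that by auto
  have desc: "descendants (pverts H) \<pi> \<delta> r = pverts H"
  proof -
    have "(\<pi> ^^ \<delta> x) x = r" if x: "x \<in> pverts H" for x
    proof (rule ccontr)
      assume "(\<pi> ^^ \<delta> x) x \<noteq> r"
      then show False using parent_tree_ancestor[OF T x, of "\<delta> x"] T by (auto simp: parent_tree_def)
    qed
    then show ?thesis using r by (auto simp: descendants_def)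
  qed
  have "{j. j < k \<and> \<tau> j \<in> pverts H} = {..<k}" using sub \<tau> by (auto simp: bij_betw_def)
  then show ?thesis
    using branch_opt_le_tree[where k = k and \<tau> = \<tau> and E = E, OF T depth sub(1) V(2) r(1)]
    by (simp add: tree_weight_def arcs sum_parent_arcs desc r tree_opt_def)
qed

text \<open>The extracted tree is known only to be no heavier than the value of the recurrence;
  equality comes from applying the lower bound to this very tree.\<close>

lemma tree_opt_attained:
  assumes I: "ddcst_instance V E T r D" and \<tau>: "bij_betw \<tau> {..<k} T"
    and fin: "tree_opt V E \<tau> (min (card V) D) r {..<k} \<noteq> \<infinity>"
  shows "\<exists>H. feasible_tree V E T r D H \<and> tree_weight E H = tree_opt V E \<tau> (min (card V) D) r {..<k}"
proof -
  let ?d = "min (card V) D"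
  have V: "finite V" "r \<in> V" using I by (auto simp: ddcst_instance_def)
  have "arcs_reach V E \<tau> ?d r {..<k} (tree_opt V E \<tau> ?d r {..<k})"
    using fin V unfolding tree_opt_def by (intro partition_min_sound branch_opt_sound) auto
  then obtain A where A: "arcs_within V E A" and reach: "\<forall>j<k. reach_within A ?d r (\<tau> j)"
    and le: "(\<Sum>(i, j)\<in>A. E i j) \<le> tree_opt V E \<tau> ?d r {..<k}"
    unfolding arcs_reach_def by auto
  obtain U \<pi> \<delta> where T: "parent_tree U r \<pi> \<delta>" and U: "\<forall>x\<in>U. \<delta> x \<le> ?d" "U \<subseteq> V"
    "{x. reach_within A ?d r x} \<subseteq> U" "parent_arcs U r \<pi> \<subseteq> A"
    using parent_tree_of_arcs[OF A V, of ?d] by blast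
  let ?H = "\<lparr>pverts = U, parcs = parent_arcs U r \<pi>\<rparr>"
  have "T \<subseteq> U" using reach U(3) \<tau> by (fastforce simp: bij_betw_def)
  moreover have "\<forall>x\<in>U - {r}. E (\<pi> x) x \<noteq> \<infinity>"
    using U(4) A by (fastforce simp: parent_arcs_def arcs_within_def)
  ultimately have feas: "feasible_tree V E T r D ?H"
    using T U by (intro feasible_tree_of_parent_tree) auto
  have "tree_weight E ?H \<le> (\<Sum>(i, j)\<in>A. E i j)"
    using U(4) A unfolding tree_weight_def by (intro sum_mono2) (auto simp: arcs_within_def)
  then have "tree_weight E ?H = tree_opt V E \<tau> ?d r {..<k}"
    using le tree_opt_le_feasible[OF I \<tau> feas] by auto
  then show ?thesis using feas by blast
qed

text \<open>Makes infinity an unambiguous sign of infeasibility: finitely many arcs of finite weight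
  never add up to it.\<close>

lemma feasible_tree_weight_finite:
  assumes "feasible_tree V E T r D H" "finite V"
  shows "tree_weight E H \<noteq> \<infinity>"
proof -
  have "finite (parcs H)" "\<forall>(i, j)\<in>parcs H. E i j \<noteq> \<infinity>"
    using assms finite_subset[of "parcs H" "V \<times> V"] unfolding feasible_tree_def subgraph_of_iff by blast+
  then show ?thesis unfolding tree_weight_def by (auto simp: less_top)
qed

lemma ddcst_solution_tree_opt:
  assumes I: "ddcst_instance V E T r D" and \<tau>: "bij_betw \<tau> {..<k} T"
  defines "w \<equiv> tree_opt V E \<tau> (min (card V) D) r {..<k}"
  shows "ddcst_solution V E T r D (if w = \<infinity> then None else Some w)"
proof (cases "w = \<infinity>")
  case True
  have "finite V" using I by (simp add: ddcst_instance_def)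
  then show ?thesis using True tree_opt_le_feasible[OF I \<tau>] feasible_tree_weight_finite
    by (fastforce simp: w_def top_unique)
next
  case False
  then show ?thesis using tree_opt_attained[OF I \<tau>] tree_opt_le_feasible[OF I \<tau>] by (simp add: w_def)
qed

section \<open>Total correctness with a time bound\<close>

definition runs :: "com \<Rightarrow> store \<Rightarrow> nat \<Rightarrow> (store \<Rightarrow> bool) \<Rightarrow> bool" where
  "runs c s B Q \<longleftrightarrow> (\<exists>t s'. exec c s t s' \<and> t \<le> B \<and> Q s')"

lemma runs_mono:
  assumes "runs c s B Q" "B \<le> B'" "\<And>s'. Q s' \<Longrightarrow> Q' s'"
  shows "runs c s B' Q'"
  using assms unfolding runs_def by (meson order_trans)

lemma runs_Seq: "runs c s A (\<lambda>s'. runs d s' B Q) \<Longrightarrow> runs (Seq c d) s (A + B) Q"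
  unfolding runs_def by (meson exec.Seq add_mono)

lemma runs_Seq_mono:
  assumes "runs c s A R" "\<And>s'. R s' \<Longrightarrow> runs d s' B Q" "A + B \<le> C"
  shows "runs (Seq c d) s C Q"
  using runs_Seq runs_mono assms by (metis (no_types, lifting) order_refl)

lemma runs_NAssign:
  "Q (nupd a (nval e s) (nval f s) s) \<Longrightarrow> runs (NAssign a e f) s (1 + ncost e + ncost f) Q"
  unfolding runs_def by (meson exec.NAssign order_refl)

lemma runs_WAssign:
  "Q (wupd a (nval e s) (wval f s) s) \<Longrightarrow> runs (WAssign a e f) s (1 + ncost e + wcost f) Q"
  unfolding runs_def by (meson exec.WAssign order_refl)

lemma runs_NAssignI:
  assumes "Q (nupd a (nval e s) (nval f s) s)" "1 + ncost e + ncost f \<le> C"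
  shows "runs (NAssign a e f) s C Q"
  using runs_mono[OF runs_NAssign] assms by blast

lemma runs_WAssignI:
  assumes "Q (wupd a (nval e s) (wval f s) s)" "1 + ncost e + wcost f \<le> C"
  shows "runs (WAssign a e f) s C Q"
  using runs_mono[OF runs_WAssign] assms by blast

lemma runs_NAssign_Seq:
  assumes "runs d (nupd a (nval e s) (nval f s) s) B Q" "1 + ncost e + ncost f + B \<le> C"
  shows "runs (Seq (NAssign a e f) d) s C Q"
  using runs_mono[OF runs_Seq[OF runs_NAssign]] assms by blast


lemma nats_nupd [simp]:
  "nats (nupd a i x s) b = (if a = b then (nats s b)(i := x) else nats s b)"
  by (simp add: nupd_def)

lemma nats_wupd [simp]: "nats (wupd a i x s) = nats s"
  by (simp add: wupd_def)

lemma weights_nupd [simp]: "weights (nupd a i x s) = weights s"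
  by (simp add: nupd_def)

lemma weights_wupd [simp]:
  "weights (wupd a i x s) b = (if a = b then (weights s b)(i := x) else weights s b)"
  by (simp add: wupd_def)

fun nat_writes :: "com \<Rightarrow> string set" where
  "nat_writes Skip = {}"
| "nat_writes (NAssign a e f) = {a}"
| "nat_writes (WAssign a e f) = {}"
| "nat_writes (Seq c d) = nat_writes c \<union> nat_writes d"
| "nat_writes (Cond b c d) = nat_writes c \<union> nat_writes d"
| "nat_writes (While b c) = nat_writes c"

fun weight_writes :: "com \<Rightarrow> string set" where
  "weight_writes Skip = {}"
| "weight_writes (NAssign a e f) = {}"
| "weight_writes (WAssign a e f) = {a}"
| "weight_writes (Seq c d) = weight_writes c \<union> weight_writes d"
| "weight_writes (Cond b c d) = weight_writes c \<union> weight_writes d"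
| "weight_writes (While b c) = weight_writes c"

text \<open>Computed from the program text at the granularity of whole arrays. Anything finer, such
  as earlier rows of a table surviving, has to be part of a postcondition.\<close>

definition frame :: "com \<Rightarrow> store \<Rightarrow> store \<Rightarrow> bool" where
  "frame c s s' \<longleftrightarrow> (\<forall>a. a \<notin> nat_writes c \<longrightarrow> nats s' a = nats s a) \<and>
     (\<forall>a. a \<notin> weight_writes c \<longrightarrow> weights s' a = weights s a)"

lemma frame_nats: "frame c s s' \<Longrightarrow> a \<notin> nat_writes c \<Longrightarrow> nats s' a = nats s a"
  by (simp add: frame_def)

lemma frame_weights: "frame c s s' \<Longrightarrow> a \<notin> weight_writes c \<Longrightarrow> weights s' a = weights s a"
  by (simp add: frame_def)

lemma exec_frame: "exec c s t s' \<Longrightarrow> frame c s s'"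
  by (induction rule: exec.induct) (auto simp: frame_def)

lemma runs_frame: "runs c s B Q \<Longrightarrow> runs c s B (\<lambda>s'. Q s' \<and> frame c s s')"
  unfolding runs_def by (meson exec_frame)

abbreviation scalar :: "string \<Rightarrow> nexp" where
  "scalar x \<equiv> NCell x (Const 0)"

definition For_loop :: "string \<Rightarrow> nexp \<Rightarrow> com \<Rightarrow> com" where
  "For_loop x e c =
     Seq (NAssign x (Const 0) (Const 0))
       (While (NLess (scalar x) e) (Seq c (NAssign x (Const 0) (NAdd (scalar x) (Const 1)))))"

lemma writes_For_loop [simp]:
  "nat_writes (For_loop x e c) = insert x (nat_writes c)"
  "weight_writes (For_loop x e c) = weight_writes c"
  by (auto simp: For_loop_def)

text \<open>The bound \<open>e\<close> is evaluated afresh at every test, so its value must be the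
  same in all stores that respect the frame; likewise \<open>I\<close> must not depend on the
  counter cell. A round costs \<open>ncost e + 4\<close> for the test and \<open>6\<close> for the
  increment besides the body; the initialisation costs \<open>3\<close>.\<close>

lemma runs_For:
  assumes x: "x \<notin> nat_writes c"
    and bound: "\<And>s'. frame (For_loop x e c) s s' \<Longrightarrow> nval e s' = N"
    and inv: "\<And>i s' v. I i s' \<Longrightarrow> I i (nupd x 0 v s')"
    and init: "I 0 s"
    and body: "\<And>i s'. i < N \<Longrightarrow> I i s' \<Longrightarrow> nats s' x 0 = i \<Longrightarrow> frame (For_loop x e c) s s' \<Longrightarrow>
      runs c s' (B i) (I (Suc i))"
  shows "runs (For_loop x e c) s ((\<Sum>i<N. B i + (ncost e + 10)) + (ncost e + 7))
    (\<lambda>s'. I N s' \<and> frame (For_loop x e c) s s')"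
proof -
  let ?F = "frame (For_loop x e c) s" and ?b = "NLess (scalar x) e"
  let ?c = "Seq c (NAssign x (Const 0) (NAdd (scalar x) (Const 1)))"
  have loop: "runs (While ?b ?c) s' ((\<Sum>i\<in>{i..<N}. B i + (ncost e + 10)) + (ncost e + 4))
      (\<lambda>s'. I N s' \<and> ?F s')"
    if "i \<le> N" "I i s'" "nats s' x 0 = i" "?F s'" for i s'
    using that
  proof (induction "N - i" arbitrary: i s')
    case 0
    then have "\<not> bval ?b s'" "i = N" using bound by auto
    then have "exec (While ?b ?c) s' (1 + bcost ?b) s'" by (intro exec.WhileFalse)
    then show ?case unfolding runs_def using 0 \<open>i = N\<close> by force
  next
    case (Suc m)
    then have i: "i < N" by auto
    then have b: "bval ?b s'" using Suc.prems bound by auto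
    obtain t s1 where c: "exec c s' t s1" "t \<le> B i" "I (Suc i) s1"
      using body[OF i Suc.prems(2-4)] unfolding runs_def by blast
    define s2 where "s2 = nupd x 0 (Suc i) s1"
    have fr: "frame c s' s1" using c(1) by (rule exec_frame)
    have "nats s1 x 0 = i" using frame_nats[OF fr x] Suc.prems by simp
    then have "exec (NAssign x (Const 0) (NAdd (scalar x) (Const 1))) s1 6 s2"
      using exec.NAssign[of x "Const 0" "NAdd (scalar x) (Const 1)" s1]
      by (simp add: s2_def eval_nat_numeral)
    with c(1) have c': "exec ?c s' (t + 6) s2" by (rule exec.Seq)
    have m: "m = N - Suc i" using Suc.hyps(2) by simp
    have "?F s2" using Suc.prems(4) fr unfolding frame_def s2_def by auto
    then obtain u s3 where w: "exec (While ?b ?c) s2 u s3"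
      "u \<le> (\<Sum>i\<in>{Suc i..<N}. B i + (ncost e + 10)) + (ncost e + 4)" "I N s3" "?F s3"
      using Suc.hyps(1)[of "Suc i" s2] m i inv[OF c(3)] unfolding s2_def runs_def by auto
    have "exec (While ?b ?c) s' (1 + bcost ?b + (t + 6) + u) s3"
      using b c' w(1) by (rule exec.WhileTrue)
    moreover have "1 + bcost ?b + (t + 6) + u \<le>
        (\<Sum>i\<in>{i..<N}. B i + (ncost e + 10)) + (ncost e + 4)"
      using w(2) c(2) i by (simp add: sum.atLeast_Suc_lessThan)
    ultimately show ?case unfolding runs_def using w by blast
  qed
  have "?F (nupd x 0 0 s)" by (simp add: frame_def)
  then have "runs (While ?b ?c) (nupd x 0 0 s)
      ((\<Sum>i<N. B i + (ncost e + 10)) + (ncost e + 4)) (\<lambda>s'. I N s' \<and> ?F s')"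
    using loop[of 0 "nupd x 0 0 s"] inv[OF init] by (simp add: lessThan_atLeast0)
  then show ?thesis unfolding For_loop_def
    by (intro runs_Seq_mono[OF runs_NAssign]) (auto simp: For_loop_def)
qed

lemma runs_For_const:
  assumes "x \<notin> nat_writes c" "\<And>s'. frame (For_loop x e c) s s' \<Longrightarrow> nval e s' = N"
    "\<And>i s' v. I i s' \<Longrightarrow> I i (nupd x 0 v s')" "I 0 s"
    "\<And>i s'. i < N \<Longrightarrow> I i s' \<Longrightarrow> nats s' x 0 = i \<Longrightarrow> frame (For_loop x e c) s s' \<Longrightarrow>
      runs c s' B (I (Suc i))"
    and B: "N * (B + ncost e + 10) + ncost e + 7 \<le> C"
  shows "runs (For_loop x e c) s C (\<lambda>s'. I N s' \<and> frame (For_loop x e c) s s')"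
  by (rule runs_mono[OF runs_For[where B = "\<lambda>_. B", OF assms(1-5)]]) (use B in \<open>auto simp: algebra_simps\<close>)

definition Relax :: "string \<Rightarrow> nexp \<Rightarrow> wexp \<Rightarrow> com" where
  "Relax a i e = Cond (WLess e (WCell a i)) (WAssign a i e) Skip"

lemma writes_Relax [simp]: "nat_writes (Relax a i e) = {}" "weight_writes (Relax a i e) = {a}"
  by (auto simp: Relax_def)

text \<open>If nothing is lowered, writing back the old value does not change the store, so one
  description covers both outcomes.\<close>

lemma runs_Relax:
  assumes "Q (wupd a (nval i s) (min (weights s a (nval i s)) (wval e s)) s)"
    and "2 * ncost i + 2 * wcost e + 4 \<le> C"
  shows "runs (Relax a i e) s C Q"
proof (cases "wval e s < weights s a (nval i s)")
  case True
  then have "exec (Relax a i e) s (1 + bcost (WLess e (WCell a i)) + (1 + ncost i + wcost e))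
      (wupd a (nval i s) (wval e s) s)"
    unfolding Relax_def by (intro exec.CondTrue exec.WAssign) simp
  moreover have "min (weights s a (nval i s)) (wval e s) = wval e s" using True by simp
  ultimately show ?thesis unfolding runs_def using assms by fastforce
next
  case False
  then have "exec (Relax a i e) s (1 + bcost (WLess e (WCell a i)) + 1) s"
    unfolding Relax_def by (intro exec.CondFalse exec.Skip) simp
  moreover have "wupd a (nval i s) (weights s a (nval i s)) s = s" by (simp add: wupd_def)
  moreover have "min (weights s a (nval i s)) (wval e s) = weights s a (nval i s)"
    using leI[OF False] by (rule min_absorb1)
  ultimately show ?thesis unfolding runs_def using assms by fastforce
qed

section \<open>Bit masks\<close>

text \<open>For disjoint sets addition replaces the bitwise disjunction that the machine
  lacks.\<close>

lemma set_encode_Un: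
  assumes "finite A" "finite B" "A \<inter> B = {}"
  shows "set_encode (A \<union> B) = set_encode A + set_encode B"
  using assms by (simp add: set_encode_def sum.union_disjoint)

lemma set_encode_less:
  assumes "A \<subseteq> {..<k}"
  shows "set_encode A < 2 ^ k"
proof -
  have "set_encode A \<le> (\<Sum>i<k. 2 ^ i)" unfolding set_encode_def
    using assms by (intro sum_mono2) auto
  also have "\<dots> < (2::nat) ^ k" by (induction k) auto
  finally show ?thesis .
qed

lemma set_encode_lessThan: "set_encode {..<k} = 2 ^ k - 1"
  unfolding set_encode_def by (induction k) auto

text \<open>
  Without bit operations the machine cannot enumerate the subsets of a mask. It tabulates all pairs
  of disjoint masks instead; those below \<open>2 ^ j\<close> occupy the first \<open>3 ^ j\<close> entries.
\<close>

definition mask_pairs :: "nat \<Rightarrow> (nat \<Rightarrow> nat) \<Rightarrow> (nat \<Rightarrow> nat) \<Rightarrow> bool" where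
  "mask_pairs j P Q \<longleftrightarrow>
     (\<lambda>i. (P i, Q i)) ` {..<3 ^ j} =
     (\<lambda>(A, B). (set_encode A, set_encode B)) ` {(A, B). A \<subseteq> {..<j} \<and> B \<subseteq> {..<j} \<and> A \<inter> B = {}}"

lemma mask_pairs_cong:
  assumes "mask_pairs j P Q" "\<And>i. i < 3 ^ j \<Longrightarrow> P' i = P i \<and> Q' i = Q i"
  shows "mask_pairs j P' Q'"
proof -
  have "(\<lambda>i. (P' i, Q' i)) ` {..<3 ^ j} = (\<lambda>i. (P i, Q i)) ` {..<3 ^ j}"
    using assms(2) by (intro image_cong) auto
  then show ?thesis using assms(1) by (simp add: mask_pairs_def)
qed

lemma mask_pairs_0:
  assumes "P 0 = 0" "Q 0 = 0"
  shows "mask_pairs 0 P Q"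
proof -
  have "{(A, B). A \<subseteq> {..<0::nat} \<and> B \<subseteq> {..<0::nat} \<and> A \<inter> B = {}} = {({}, {})}" by auto
  then show ?thesis using assms by (simp add: mask_pairs_def lessThan_Suc)
qed

lemma mask_pairs_D:
  assumes "mask_pairs j P Q" "i < 3 ^ j"
  obtains A B where "A \<subseteq> {..<j}" "B \<subseteq> {..<j}" "A \<inter> B = {}" "P i = set_encode A" "Q i = set_encode B"
proof -
  have "(P i, Q i) \<in> (\<lambda>i. (P i, Q i)) ` {..<3 ^ j}" using assms(2) by auto
  then show ?thesis using that assms(1) unfolding mask_pairs_def by auto
qed

lemma mask_pairs_I:
  assumes "mask_pairs j P Q" "A \<subseteq> {..<j}" "B \<subseteq> {..<j}" "A \<inter> B = {}"
  obtains i where "i < 3 ^ j" "P i = set_encode A" "Q i = set_encode B"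
proof -
  have "(set_encode A, set_encode B) \<in>
      (\<lambda>(A, B). (set_encode A, set_encode B)) ` {(A, B). A \<subseteq> {..<j} \<and> B \<subseteq> {..<j} \<and> A \<inter> B = {}}"
    using assms by auto
  then have "(set_encode A, set_encode B) \<in> (\<lambda>i. (P i, Q i)) ` {..<3 ^ j}"
    using assms(1) by (simp only: mask_pairs_def)
  then show ?thesis using that by auto
qed

lemma set_encode_insert_above: "A \<subseteq> {..<j} \<Longrightarrow> set_encode (insert j A) = set_encode A + 2 ^ j"
  by (subst set_encode_insert) (auto intro: finite_subset)

text \<open>The new element \<open>j\<close> lies in neither set, in the first or in the second;
  these cases are the three copies of the old table. Only the image is tracked, since order and
  repetition do not affect a minimum.\<close>

lemma mask_pairs_Suc:
  assumes old: "mask_pairs j P Q"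
    and new: "\<And>i. i < 3 ^ j \<Longrightarrow> P' i = P i \<and> Q' i = Q i \<and>
      P' (3 ^ j + i) = P i + 2 ^ j \<and> Q' (3 ^ j + i) = Q i \<and>
      P' (3 ^ j + 3 ^ j + i) = P i \<and> Q' (3 ^ j + 3 ^ j + i) = Q i + 2 ^ j"
  shows "mask_pairs (Suc j) P' Q'"
  unfolding mask_pairs_def
proof (intro equalityI subsetI)
  let ?S = "{(A, B). A \<subseteq> {..<Suc j} \<and> B \<subseteq> {..<Suc j} \<and> A \<inter> B = {}}"
  fix z assume "z \<in> (\<lambda>i. (P' i, Q' i)) ` {..<3 ^ Suc j}"
  then obtain i where i: "i < 3 ^ Suc j" "z = (P' i, Q' i)" by auto
  have "\<exists>A B. (A, B) \<in> ?S \<and> P' i = set_encode A \<and> Q' i = set_encode B"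
  proof -
    consider "i < 3 ^ j" | i' where "i = 3 ^ j + i'" "i' < 3 ^ j"
      | i' where "i = 3 ^ j + 3 ^ j + i'" "i' < 3 ^ j"
    proof (cases "i < 3 ^ j")
      case False
      note ge = this
      show ?thesis
      proof (cases "i < 3 ^ j + 3 ^ j")
        case True
        then show ?thesis using that(2)[of "i - 3 ^ j"] ge by simp
      next
        case False
        then show ?thesis using that(3)[of "i - (3 ^ j + 3 ^ j)"] i(1) by simp
      qed
    qed
    then show ?thesis
    proof cases
      case 1
      obtain A B where "A \<subseteq> {..<j}" "B \<subseteq> {..<j}" "A \<inter> B = {}" "P i = set_encode A" "Q i = set_encode B"
        using mask_pairs_D[OF old 1] .
      then show ?thesis using new[OF 1] by (intro exI[of _ A] exI[of _ B]) (auto simp: less_Suc_eq)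
    next
      case 2
      obtain A B where AB: "A \<subseteq> {..<j}" "B \<subseteq> {..<j}" "A \<inter> B = {}" "P i' = set_encode A" "Q i' = set_encode B"
        using mask_pairs_D[OF old 2(2)] .
      then show ?thesis using new[OF 2(2)] unfolding 2(1)
        by (intro exI[of _ "insert j A"] exI[of _ B]) (auto simp: set_encode_insert_above less_Suc_eq)
    next
      case 3
      obtain A B where AB: "A \<subseteq> {..<j}" "B \<subseteq> {..<j}" "A \<inter> B = {}" "P i' = set_encode A" "Q i' = set_encode B"
        using mask_pairs_D[OF old 3(2)] .
      then show ?thesis using new[OF 3(2)] unfolding 3(1)
        by (intro exI[of _ A] exI[of _ "insert j B"]) (auto simp: set_encode_insert_above less_Suc_eq)
    qed
  qed
  then show "z \<in> (\<lambda>(A, B). (set_encode A, set_encode B)) ` ?S" using i(2) by force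
next
  let ?S = "{(A, B). A \<subseteq> {..<Suc j} \<and> B \<subseteq> {..<Suc j} \<and> A \<inter> B = {}}"
  fix z assume "z \<in> (\<lambda>(A, B). (set_encode A, set_encode B)) ` ?S"
  then obtain A B where AB: "A \<subseteq> {..<Suc j}" "B \<subseteq> {..<Suc j}" "A \<inter> B = {}"
    and z: "z = (set_encode A, set_encode B)" by auto
  have sub: "A - {j} \<subseteq> {..<j}" "B - {j} \<subseteq> {..<j}" "(A - {j}) \<inter> (B - {j}) = {}"
    using AB by (auto simp: less_Suc_eq)
  obtain i where i: "i < 3 ^ j" "P i = set_encode (A - {j})" "Q i = set_encode (B - {j})"
    using mask_pairs_I[OF old sub] .
  have enc: "set_encode X = set_encode (X - {j}) + (if j \<in> X then 2 ^ j else 0)"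
    if "X - {j} \<subseteq> {..<j}" for X
    using set_encode_insert_above[OF that] by (auto simp: insert_absorb)
  have "\<exists>i'<3 ^ Suc j. P' i' = set_encode A \<and> Q' i' = set_encode B"
  proof -
    consider "j \<notin> A" "j \<notin> B" | "j \<in> A" "j \<notin> B" | "j \<notin> A" "j \<in> B" using AB by auto
    then show ?thesis
    proof cases
      case 1
      then show ?thesis using new[OF i(1)] i by (intro exI[of _ i]) auto
    next
      case 2
      then show ?thesis using new[OF i(1)] i enc[OF sub(1)] by (intro exI[of _ "3 ^ j + i"]) auto
    next
      case 3
      then show ?thesis using new[OF i(1)] i enc[OF sub(2)] by (intro exI[of _ "3 ^ j + 3 ^ j + i"]) auto
    qed
  qed
  then show "z \<in> (\<lambda>i. (P' i, Q' i)) ` {..<3 ^ Suc j}" using z by force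
qed

section \<open>The program\<close>

lemma mult_add_less: "v' < v \<Longrightarrow> x < K \<Longrightarrow> v' * K + x < v * (K::nat)"
proof -
  assume "v' < v" "x < K"
  then have "v' * K + x < Suc v' * K" by simp
  also have "\<dots> \<le> v * K" using \<open>v' < v\<close> by (intro mult_right_mono) auto
  finally show ?thesis .
qed

text \<open>\<open>rowE\<close> and \<open>rowF\<close> hold the products needed as row offsets,
  which cannot be computed on demand without multiplication.\<close>

definition prepared :: "nat \<Rightarrow> nat \<Rightarrow> store \<Rightarrow> bool" where
  "prepared n k s \<longleftrightarrow> nats s ''n'' 0 = n \<and> nats s ''k'' 0 = k \<and> nats s ''K'' 0 = 2 ^ k \<and>
     (\<forall>v<n. nats s ''rowE'' v = v * n \<and> nats s ''rowF'' v = v * 2 ^ k) \<and>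
     (\<forall>j<k. nats s ''pow2'' j = 2 ^ j \<and> nats s ''pow3'' j = 3 ^ j \<and>
        mask_pairs j (nats s ''P'') (nats s ''Q''))"

lemma prepared_frame:
  assumes "prepared n k s" "frame c s s'"
    "nat_writes c \<inter> {''n'', ''k'', ''K'', ''rowE'', ''rowF'', ''pow2'', ''pow3'', ''P'', ''Q''} = {}"
  shows "prepared n k s'"
proof -
  have "\<forall>a\<in>{''n'', ''k'', ''K'', ''rowE'', ''rowF'', ''pow2'', ''pow3'', ''P'', ''Q''}. nats s' a = nats s a"
    using assms(2,3) by (meson disjoint_iff frame_nats)
  then show ?thesis using assms(1) by (simp add: prepared_def)
qed

section \<open>Minimising over partitions\<close>

definition fill_row :: "string \<Rightarrow> com" where
  "fill_row a = For_loop ''m'' (scalar ''K'')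
     (WAssign a (NAdd (NCell ''rowF'' (scalar ''v'')) (scalar ''m'')) WInf)"

lemma writes_fill_row [simp]:
  "nat_writes (fill_row a) = {''m''}" "weight_writes (fill_row a) = {a}"
  by (auto simp: fill_row_def)

text \<open>The postcondition describes the whole array, so that it also shows the other rows
  intact.\<close>

lemma runs_fill_row:
  assumes p: "prepared n k s" and v: "nats s ''v'' 0 = v" "v < n"
  shows "runs (fill_row a) s (40 * 2 ^ k) (\<lambda>s'.
    weights s' a = (\<lambda>c. if v * 2 ^ k \<le> c \<and> c < v * 2 ^ k + 2 ^ k then \<infinity> else weights s a c) \<and>
    frame (fill_row a) s s')"
  unfolding fill_row_def
proof (rule runs_For_const[where N = "2 ^ k" and B = 10 and I = "\<lambda>i s'. weights s' a =
    (\<lambda>c. if v * 2 ^ k \<le> c \<and> c < v * 2 ^ k + i then \<infinity> else weights s a c)"], goal_cases)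
  case (2 s')
  then have "nats s' ''K'' = nats s ''K''" by (rule frame_nats) simp
  then show ?case using p by (simp add: prepared_def)
next
  case (5 i s')
  note fr = frame_nats[OF 5(4)]
  have "nats s' ''rowF'' v = v * 2 ^ k" "nats s' ''v'' 0 = v"
    using p v fr[of "''rowF''"] fr[of "''v''"] by (auto simp: prepared_def)
  then show ?case
    using 5(2,3) by (intro runs_WAssignI) (auto simp: fun_eq_iff)
next
  case 6
  have "(1::nat) \<le> 2 ^ k" by simp
  then show ?case by simp
qed (auto simp: fun_eq_iff)

text \<open>A pair of disjoint sets \<open>A\<close>, \<open>B\<close> below \<open>j\<close> is a
  candidate for the set formed by \<open>A\<close>, \<open>B\<close> and \<open>j\<close>: the block
  containing \<open>j\<close> has mask \<open>P + 2 ^ j\<close> and is read from \<open>H\<close>,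
  the rest has mask \<open>Q\<close> and is read from \<open>F\<close>.\<close>

definition glue_inner :: com where
  "glue_inner = For_loop ''i'' (NCell ''pow3'' (scalar ''j''))
     (Relax ''F''
       (NAdd (NCell ''rowF'' (scalar ''v''))
         (NAdd (NAdd (NCell ''P'' (scalar ''i'')) (NCell ''Q'' (scalar ''i''))) (NCell ''pow2'' (scalar ''j''))))
       (WAdd
         (WCell ''H'' (NAdd (NCell ''rowF'' (scalar ''v''))
           (NAdd (NCell ''P'' (scalar ''i'')) (NCell ''pow2'' (scalar ''j'')))))
         (WCell ''F'' (NAdd (NCell ''rowF'' (scalar ''v'')) (NCell ''Q'' (scalar ''i''))))))"

lemma writes_glue_inner [simp]:
  "nat_writes glue_inner = {''i''}" "weight_writes glue_inner = {''F''}"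
  by (auto simp: glue_inner_def)

text \<open>Separates reads from writes in \<open>glue_inner\<close>: \<open>F\<close> is read in
  columns below \<open>2 ^ j\<close> and written in columns from \<open>2 ^ j\<close> to
  \<open>2 ^ Suc j - 1\<close>.\<close>

lemma mask_pairs_sum_less:
  assumes "mask_pairs j P Q" "i < 3 ^ j"
  shows "P i + Q i < 2 ^ j" "Q i < 2 ^ j"
proof -
  obtain A B where AB: "A \<subseteq> {..<j}" "B \<subseteq> {..<j}" "A \<inter> B = {}" "P i = set_encode A" "Q i = set_encode B"
    using mask_pairs_D[OF assms] .
  have "finite A" "finite B" using AB finite_subset by blast+
  then have "P i + Q i = set_encode (A \<union> B)" using AB by (simp add: set_encode_Un)
  then show "P i + Q i < 2 ^ j" using set_encode_less[of "A \<union> B" j] AB by simp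
  then show "Q i < 2 ^ j" by simp
qed

lemma INF_less_Suc:
  fixes f :: "nat \<Rightarrow> ennreal"
  shows "(INF i\<in>{i. i < Suc m \<and> p i}. f i) =
    (if p m then min (INF i\<in>{i. i < m \<and> p i}. f i) (f m) else (INF i\<in>{i. i < m \<and> p i}. f i))"
proof -
  have "{i. i < Suc m \<and> p i} = (if p m then insert m {i. i < m \<and> p i} else {i. i < m \<and> p i})"
    by (auto simp: less_Suc_eq)
  then show ?thesis by (simp add: inf_min min.commute)
qed

text \<open>The running minimum after the first \<open>m\<close> pairs, for the target mask
  \<open>x + 2 ^ j\<close>. For \<open>m = 0\<close> the infimum is over the empty set, hence
  infinite, in agreement with the filled row.\<close>

definition glue_value :: "(nat \<Rightarrow> nat) \<Rightarrow> (nat \<Rightarrow> nat) \<Rightarrow> (nat \<Rightarrow> ennreal) \<Rightarrow> (nat \<Rightarrow> ennreal) \<Rightarrow>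
    nat \<Rightarrow> nat \<Rightarrow> nat \<Rightarrow> nat \<Rightarrow> ennreal" where
  "glue_value P Q H F off j m x =
     (INF i\<in>{i. i < m \<and> P i + Q i = x}. H (off + (P i + 2 ^ j)) + F (off + Q i))"

lemma runs_glue_inner:
  assumes p: "prepared n k s" and v: "nats s ''v'' 0 = v" "v < n" and j: "nats s ''j'' 0 = j" "j < k"
    and inf: "\<And>x. x < 2 ^ j \<Longrightarrow> weights s ''F'' (v * 2 ^ k + (x + 2 ^ j)) = \<infinity>"
  shows "runs glue_inner s (120 * 3 ^ j) (\<lambda>s'.
    (\<forall>x<2 ^ j. weights s' ''F'' (v * 2 ^ k + (x + 2 ^ j)) = glue_value (nats s ''P'') (nats s ''Q'')
        (weights s ''H'') (weights s ''F'') (v * 2 ^ k) j (3 ^ j) x) \<and>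
    (\<forall>c. c < v * 2 ^ k + 2 ^ j \<or> v * 2 ^ k + 2 ^ Suc j \<le> c \<longrightarrow> weights s' ''F'' c = weights s ''F'' c) \<and>
    frame glue_inner s s')"
proof -
  let ?P = "nats s ''P''" and ?Q = "nats s ''Q''" and ?H = "weights s ''H''" and ?F = "weights s ''F''"
  let ?o = "v * 2 ^ k"
  let ?I = "\<lambda>m s'. (\<forall>x<2 ^ j. weights s' ''F'' (?o + (x + 2 ^ j)) = glue_value ?P ?Q ?H ?F ?o j m x) \<and>
    (\<forall>c. c < ?o + 2 ^ j \<or> ?o + 2 ^ Suc j \<le> c \<longrightarrow> weights s' ''F'' c = ?F c)"
  have mp: "mask_pairs j ?P ?Q" using p j by (simp add: prepared_def)
  have "runs glue_inner s (120 * 3 ^ j) (\<lambda>s'. ?I (3 ^ j) s' \<and> frame glue_inner s s')"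
    unfolding glue_inner_def
  proof (rule runs_For_const[where I = ?I and N = "3 ^ j" and B = 90], goal_cases)
    case (2 s')
    note fr = frame_nats[OF 2]
    have "nats s' ''pow3'' = nats s ''pow3''" "nats s' ''j'' = nats s ''j''"
      by (rule fr; simp)+
    then show ?case using p j by (simp add: prepared_def)
  next
    case 4
    then show ?case using inf by (simp add: glue_value_def)
  next
    case (5 i s')
    note fr = frame_nats[OF 5(4)]
    have "prepared n k s'" using prepared_frame[OF p 5(4)] by simp
    then have eqs: "nats s' ''rowF'' v = ?o" "nats s' ''pow2'' j = 2 ^ j"
      using v(2) j(2) by (simp_all add: prepared_def)
    have eqs': "nats s' ''v'' 0 = v" "nats s' ''j'' 0 = j"
      "nats s' ''P'' = ?P" "nats s' ''Q'' = ?Q" "weights s' ''H'' = ?H" "nats s' ''i'' 0 = i"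
      using v j 5(3) fr[of "''v''"] fr[of "''j''"] fr[of "''P''"]
        fr[of "''Q''"] frame_weights[OF 5(4), of "''H''"] by simp_all
    have lt: "?P i + ?Q i < 2 ^ j" "?Q i < 2 ^ j" using mask_pairs_sum_less[OF mp 5(1)] by auto
    let ?c = "?o + (?P i + ?Q i + 2 ^ j)"
    let ?w = "?H (?o + (?P i + 2 ^ j)) + ?F (?o + ?Q i)"
    \<comment> \<open>The cell read has not been touched by this loop, so the old contents may stand
      in \<open>glue_value\<close>.\<close>
    have F: "weights s' ''F'' (?o + ?Q i) = ?F (?o + ?Q i)" using 5(2) lt by auto
    have old: "weights s' ''F'' ?c = glue_value ?P ?Q ?H ?F ?o j i (?P i + ?Q i)" using 5(2) lt(1) by blast
    have "?I (Suc i) (wupd ''F'' ?c (min (weights s' ''F'' ?c) ?w) s')"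
    proof (intro conjI allI impI)
      fix x :: nat assume x: "x < 2 ^ j"
      have "weights s' ''F'' (?o + (x + 2 ^ j)) = glue_value ?P ?Q ?H ?F ?o j i x" using 5(2) x by blast
      then show "weights (wupd ''F'' ?c (min (weights s' ''F'' ?c) ?w) s') ''F'' (?o + (x + 2 ^ j)) =
          glue_value ?P ?Q ?H ?F ?o j (Suc i) x"
        using old unfolding glue_value_def INF_less_Suc by auto
    next
      fix c assume "c < ?o + 2 ^ j \<or> ?o + 2 ^ Suc j \<le> c"
      then show "weights (wupd ''F'' ?c (min (weights s' ''F'' ?c) ?w) s') ''F'' c = ?F c"
        using 5(2) lt(1) by auto
    qed
    then show ?case by (intro runs_Relax) (simp_all add: eqs eqs' F)
  next
    case 6
    have "(1::nat) \<le> 3 ^ j" by simp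
    then have "10 \<le> 17 * (3::nat) ^ j" by linarith
    then show ?case by simp
  qed simp_all
  then show ?thesis by simp
qed

text \<open>As \<open>j\<close> is the maximum of \<open>insert j X\<close>, the recurrence ranges
  over the rests \<open>R\<close> contained in \<open>X\<close>. Since \<open>set_encode\<close> is
  injective on finite sets, the pairs with mask sum \<open>set_encode X\<close> are exactly those of
  the form \<open>X - R\<close>, \<open>R\<close>.\<close>

lemma glue_value_eq_partition_min:
  assumes mp: "mask_pairs j P Q" and j: "j < k" and X: "X \<subseteq> {..<j}"
    and H: "\<And>X. X \<subseteq> {..<k} \<Longrightarrow> H (off + set_encode X) = h X"
    and F: "\<And>X. X \<subseteq> {..<j} \<Longrightarrow> F (off + set_encode X) = partition_min h X"
  shows "glue_value P Q H F off j (3 ^ j) (set_encode X) = partition_min h (insert j X)"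
proof -
  have fin: "finite X" using X finite_subset by blast
  have max: "Max (insert j X) = j" using X fin by (intro Max_eqI) auto
  have jX: "j \<notin> X" using X by auto
  have "partition_min h (insert j X) = (INF R\<in>Pow X. h (insert j X - R) + partition_min h R)"
    using fin jX by (subst partition_min_nonempty) (simp_all add: max)
  also have "\<dots> = glue_value P Q H F off j (3 ^ j) (set_encode X)"
    unfolding glue_value_def
  proof (rule antisym)
    show "(INF R\<in>Pow X. h (insert j X - R) + partition_min h R) \<le>
      (INF i\<in>{i. i < 3 ^ j \<and> P i + Q i = set_encode X}. H (off + (P i + 2 ^ j)) + F (off + Q i))"
    proof (rule INF_greatest)
      fix i assume "i \<in> {i. i < 3 ^ j \<and> P i + Q i = set_encode X}"
      then have i: "i < 3 ^ j" "P i + Q i = set_encode X" by auto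
      obtain A B where AB: "A \<subseteq> {..<j}" "B \<subseteq> {..<j}" "A \<inter> B = {}" "P i = set_encode A" "Q i = set_encode B"
        using mask_pairs_D[OF mp i(1)] .
      have fAB: "finite A" "finite B" using AB finite_subset by blast+
      then have "set_encode (A \<union> B) = set_encode X" using i AB by (simp add: set_encode_Un)
      then have XAB: "X = A \<union> B" using fin fAB by (simp add: set_encode_eq)
      have "insert j X - B = insert j A" using AB jX XAB by auto
      moreover have "H (off + (P i + 2 ^ j)) = h (insert j A)"
        using H[of "insert j A"] AB(4) j set_encode_insert_above[OF AB(1)] subset_trans[OF AB(1), of "{..<k}"]
        by (simp add: lessThan_subset_iff)
      moreover have "F (off + Q i) = partition_min h B" using F[OF AB(2)] AB(5) by simp
      ultimately show "(INF R\<in>Pow X. h (insert j X - R) + partition_min h R) \<le>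
          H (off + (P i + 2 ^ j)) + F (off + Q i)"
        using XAB by (intro INF_lower2[of B]) auto
    qed
    show "(INF i\<in>{i. i < 3 ^ j \<and> P i + Q i = set_encode X}. H (off + (P i + 2 ^ j)) + F (off + Q i)) \<le>
      (INF R\<in>Pow X. h (insert j X - R) + partition_min h R)"
    proof (rule INF_greatest)
      fix R assume "R \<in> Pow X"
      then have R: "R \<subseteq> X" by simp
      have sub: "X - R \<subseteq> {..<j}" "R \<subseteq> {..<j}" "(X - R) \<inter> R = {}" using R X by auto
      obtain i where i: "i < 3 ^ j" "P i = set_encode (X - R)" "Q i = set_encode R"
        using mask_pairs_I[OF mp sub] .
      have "set_encode (X - R) + set_encode R = set_encode ((X - R) \<union> R)"
        using fin R finite_subset by (subst set_encode_Un) auto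
      also have "(X - R) \<union> R = X" using R by auto
      finally have sum: "P i + Q i = set_encode X" using i by simp
      have "insert j X - R = insert j (X - R)" using jX R by auto
      moreover have "insert j (X - R) \<subseteq> {..<k}" using sub(1) j by auto
      ultimately have "H (off + (P i + 2 ^ j)) = h (insert j X - R)"
        using H[of "insert j (X - R)"] set_encode_insert_above[OF sub(1)] i by simp
      moreover have "F (off + Q i) = partition_min h R" using F[OF sub(2)] i by simp
      ultimately show "(INF i\<in>{i. i < 3 ^ j \<and> P i + Q i = set_encode X}. H (off + (P i + 2 ^ j)) + F (off + Q i))
          \<le> h (insert j X - R) + partition_min h R"
        using i(1) sum by (intro INF_lower2[of i]) auto
    qed
  qed
  finally show ?thesis by simp
qed

definition glue_row :: com where
  "glue_row = Seq (fill_row ''F'')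
     (Seq (WAssign ''F'' (NCell ''rowF'' (scalar ''v'')) WZero)
       (For_loop ''j'' (scalar ''k'') glue_inner))"

lemma writes_glue_row [simp]:
  "nat_writes glue_row = {''m'', ''j'', ''i''}" "weight_writes glue_row = {''F''}"
  by (auto simp: glue_row_def)

text \<open>A geometric series: the work for all top bits is of the order of \<open>3 ^ k\<close>.
  The extra summand \<open>c\<close> leaves room for the closing cost of the loop.\<close>

lemma sum_power_less: "(\<Sum>j<k. 3 ^ j * c) + c \<le> c * 3 ^ k" for c :: nat
  by (induction k) auto

lemma runs_glue_loop:
  assumes p: "prepared n k s" and v: "nats s ''v'' 0 = v" "v < n"
    and H: "\<And>X. X \<subseteq> {..<k} \<Longrightarrow> weights s ''H'' (v * 2 ^ k + set_encode X) = h X"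
    and zero: "weights s ''F'' (v * 2 ^ k) = 0"
    and inf: "\<And>x. 1 \<le> x \<Longrightarrow> x < 2 ^ k \<Longrightarrow> weights s ''F'' (v * 2 ^ k + x) = \<infinity>"
  shows "runs (For_loop ''j'' (scalar ''k'') glue_inner) s (140 * 3 ^ k) (\<lambda>s'.
    (\<forall>X\<subseteq>{..<k}. weights s' ''F'' (v * 2 ^ k + set_encode X) = partition_min h X) \<and>
    (\<forall>c<v * 2 ^ k. weights s' ''F'' c = weights s ''F'' c))"
proof -
  let ?o = "v * 2 ^ k"
  \<comment> \<open>Stage \<open>j\<close> settles the masks from \<open>2 ^ j\<close> to
    \<open>2 ^ Suc j - 1\<close>, which are the sets with maximum \<open>j\<close>. Beforehand they
    must still be infinite, as running minima start from them. The last conjunct protects the rows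
    already finished.\<close>
  let ?I = "\<lambda>j s'. (\<forall>X\<subseteq>{..<j}. weights s' ''F'' (?o + set_encode X) = partition_min h X) \<and>
    (\<forall>x. 2 ^ j \<le> x \<and> x < 2 ^ k \<longrightarrow> weights s' ''F'' (?o + x) = \<infinity>) \<and>
    (\<forall>c<?o. weights s' ''F'' c = weights s ''F'' c)"
  have "runs (For_loop ''j'' (scalar ''k'') glue_inner) s
     ((\<Sum>j<k. 120 * 3 ^ j + (ncost (scalar ''k'') + 10)) + (ncost (scalar ''k'') + 7))
     (\<lambda>s'. ?I k s' \<and> frame (For_loop ''j'' (scalar ''k'') glue_inner) s s')"
  proof (rule runs_For[where I = ?I and N = k and B = "\<lambda>j. 120 * 3 ^ j"], goal_cases)
    case (2 s')
    then have "nats s' ''k'' = nats s ''k''" by (rule frame_nats) simp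
    then show ?case using p by (simp add: prepared_def)
  next
    case 4
    have "weights s ''F'' (v * 2 ^ k + set_encode {}) = 0" using zero by simp
    then show ?case using inf by (simp del: set_encode_empty)
  next
    case (5 j s')
    note j = 5(1) and I = 5(2) and fr = 5(4)
    have p': "prepared n k s'" using prepared_frame[OF p fr] by simp
    have mp: "mask_pairs j (nats s' ''P'') (nats s' ''Q'')" using p' j by (simp add: prepared_def)
    have v': "nats s' ''v'' 0 = v" using frame_nats[OF fr, of "''v''"] v by simp
    have H': "weights s' ''H'' (?o + set_encode X) = h X" if "X \<subseteq> {..<k}" for X
      using frame_weights[OF fr, of "''H''"] H[OF that] by simp
    have pow: "(2::nat) ^ j + 2 ^ j \<le> 2 ^ k"
      using j power_increasing[of "Suc j" k "2::nat"] by simp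
    have inf': "weights s' ''F'' (?o + (x + 2 ^ j)) = \<infinity>" if "x < 2 ^ j" for x
      using I pow that by simp
    show ?case
    proof (rule runs_mono[OF runs_glue_inner[OF p' v' v(2) 5(3) j inf']], assumption, rule order_refl,
        elim conjE, intro conjI allI impI)
      fix s'' X
      assume new: "\<forall>x<2 ^ j. weights s'' ''F'' (?o + (x + 2 ^ j)) = glue_value (nats s' ''P'') (nats s' ''Q'')
          (weights s' ''H'') (weights s' ''F'') ?o j (3 ^ j) x"
        and keep: "\<forall>c. c < ?o + 2 ^ j \<or> ?o + 2 ^ Suc j \<le> c \<longrightarrow> weights s'' ''F'' c = weights s' ''F'' c"
        and X: "X \<subseteq> {..<Suc j}"
      show "weights s'' ''F'' (?o + set_encode X) = partition_min h X"
      proof (cases "j \<in> X")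
        case True
        then have eq: "X = insert j (X - {j})" and sub: "X - {j} \<subseteq> {..<j}" using X by (auto simp: less_Suc_eq)
        have "set_encode X = set_encode (X - {j}) + 2 ^ j"
          using set_encode_insert_above[OF sub] eq by metis
        moreover have "glue_value (nats s' ''P'') (nats s' ''Q'') (weights s' ''H'') (weights s' ''F'') ?o j (3 ^ j)
            (set_encode (X - {j})) = partition_min h (insert j (X - {j}))"
          using I H' by (intro glue_value_eq_partition_min[OF mp j sub]) auto
        ultimately show ?thesis using new set_encode_less[OF sub] eq by metis
      next
        case False
        then have "X \<subseteq> {..<j}" using X by (auto simp: less_Suc_eq)
        then show ?thesis using keep I set_encode_less by auto
      qed
    next
      fix s'' and x :: nat
      assume keep: "\<forall>c. c < ?o + 2 ^ j \<or> ?o + 2 ^ Suc j \<le> c \<longrightarrow> weights s'' ''F'' c = weights s' ''F'' c"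
        and x: "2 ^ Suc j \<le> x \<and> x < 2 ^ k"
      then show "weights s'' ''F'' (?o + x) = \<infinity>" using I by simp
    next
      fix s'' c
      assume keep: "\<forall>c. c < ?o + 2 ^ j \<or> ?o + 2 ^ Suc j \<le> c \<longrightarrow> weights s'' ''F'' c = weights s' ''F'' c"
        and c: "c < ?o"
      then show "weights s'' ''F'' c = weights s ''F'' c" using I by simp
    qed
  qed auto
  moreover have "(\<Sum>j<k. 120 * 3 ^ j + (ncost (scalar ''k'') + 10)) + (ncost (scalar ''k'') + 7)
      \<le> (\<Sum>j<k. 3 ^ j * 140) + (140::nat)"
  proof (intro add_mono sum_mono)
    fix j
    have "(1::nat) \<le> 3 ^ j" by simp
    then have "3 \<le> 5 * (3::nat) ^ j" by linarith
    then show "120 * 3 ^ j + (ncost (scalar ''k'') + 10) \<le> 3 ^ j * (140::nat)" by simp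
  qed simp
  ultimately show ?thesis using sum_power_less[of 140 k] by (elim runs_mono) auto
qed

lemma runs_glue_row:
  assumes p: "prepared n k s" and v: "nats s ''v'' 0 = v" "v < n"
    and H: "\<And>X. X \<subseteq> {..<k} \<Longrightarrow> weights s ''H'' (v * 2 ^ k + set_encode X) = h X"
  shows "runs glue_row s (190 * 3 ^ k) (\<lambda>s'.
    (\<forall>X\<subseteq>{..<k}. weights s' ''F'' (v * 2 ^ k + set_encode X) = partition_min h X) \<and>
    (\<forall>c<v * 2 ^ k. weights s' ''F'' c = weights s ''F'' c))"
  unfolding glue_row_def
proof (rule runs_Seq_mono[OF runs_fill_row[OF p v]])
  fix s1
  assume s1: "weights s1 ''F'' =
      (\<lambda>c. if v * 2 ^ k \<le> c \<and> c < v * 2 ^ k + 2 ^ k then \<infinity> else weights s ''F'' c) \<and>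
    frame (fill_row ''F'') s s1"
  have p1: "prepared n k s1" using prepared_frame[OF p, of "fill_row ''F''" s1] s1 by simp
  have v1: "nats s1 ''v'' 0 = v" using frame_nats[of "fill_row ''F''" s s1 "''v''"] s1 v by simp
  have H1: "weights s1 ''H'' = weights s ''H''" using frame_weights[of "fill_row ''F''" s s1 "''H''"] s1 by simp
  have row: "nats s1 ''rowF'' v = v * 2 ^ k" using p1 v(2) by (simp add: prepared_def)
  let ?s2 = "wupd ''F'' (v * 2 ^ k) 0 s1"
  have p2: "prepared n k ?s2" using p1 by (simp add: prepared_def)
  have "runs (For_loop ''j'' (scalar ''k'') glue_inner) ?s2 (140 * 3 ^ k) (\<lambda>s'.
    (\<forall>X\<subseteq>{..<k}. weights s' ''F'' (v * 2 ^ k + set_encode X) = partition_min h X) \<and>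
    (\<forall>c<v * 2 ^ k. weights s' ''F'' c = weights ?s2 ''F'' c))"
    using v1 H s1 by (intro runs_glue_loop[OF p2 _ v(2)]) (simp_all add: H1)
  then have loop: "runs (For_loop ''j'' (scalar ''k'') glue_inner) ?s2 (140 * 3 ^ k) (\<lambda>s'.
    (\<forall>X\<subseteq>{..<k}. weights s' ''F'' (v * 2 ^ k + set_encode X) = partition_min h X) \<and>
    (\<forall>c<v * 2 ^ k. weights s' ''F'' c = weights s ''F'' c))"
    by (rule runs_mono) (use s1 in auto)
  show "runs (Seq (WAssign ''F'' (NCell ''rowF'' (scalar ''v'')) WZero)
      (For_loop ''j'' (scalar ''k'') glue_inner)) s1 (5 + 140 * 3 ^ k) (\<lambda>s'.
    (\<forall>X\<subseteq>{..<k}. weights s' ''F'' (v * 2 ^ k + set_encode X) = partition_min h X) \<and>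
    (\<forall>c<v * 2 ^ k. weights s' ''F'' c = weights s ''F'' c))"
    by (rule runs_Seq_mono[OF runs_WAssign[where Q = "\<lambda>x. x = ?s2"]], simp add: v1 row,
        hypsubst, rule loop, simp)
next
  have "(2::nat) ^ k \<le> 3 ^ k" "(1::nat) \<le> 3 ^ k" by (simp_all add: power_mono)
  then show "40 * 2 ^ k + (5 + 140 * 3 ^ k) \<le> 190 * (3::nat) ^ k" by linarith
qed

definition table :: "nat \<Rightarrow> nat \<Rightarrow> (nat \<Rightarrow> nat set \<Rightarrow> ennreal) \<Rightarrow> (nat \<Rightarrow> ennreal) \<Rightarrow> bool" where
  "table n k f a \<longleftrightarrow> (\<forall>v<n. \<forall>X\<subseteq>{..<k}. a (v * 2 ^ k + set_encode X) = f v X)"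

definition glue :: com where
  "glue = For_loop ''v'' (scalar ''n'') glue_row"

lemma writes_glue [simp]:
  "nat_writes glue = {''v'', ''m'', ''j'', ''i''}" "weight_writes glue = {''F''}"
  by (auto simp: glue_def)

lemma runs_glue:
  assumes p: "prepared n k s" and H: "table n k h (weights s ''H'')" and n: "n \<ge> 1"
  shows "runs glue s (220 * (n * 3 ^ k)) (\<lambda>s'. table n k (\<lambda>v. partition_min (h v)) (weights s' ''F'') \<and> frame glue s s')"
  unfolding glue_def
proof (rule runs_For_const[where N = n and B = "190 * 3 ^ k" and
    I = "\<lambda>v s'. table v k (\<lambda>v. partition_min (h v)) (weights s' ''F'')"], goal_cases)
  case (2 s')
  then have "nats s' ''n'' = nats s ''n''" by (rule frame_nats) simp
  then show ?case using p by (simp add: prepared_def)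
next
  case (5 v s')
  have p': "prepared n k s'" using prepared_frame[OF p 5(4)] by simp
  have H': "weights s' ''H'' (v * 2 ^ k + set_encode X) = h v X" if "X \<subseteq> {..<k}" for X
    using H that frame_weights[OF 5(4), of "''H''"] 5(1) by (simp add: table_def)
  show ?case
  proof (rule runs_mono[OF runs_glue_row[OF p' 5(3,1) H']], assumption, rule order_refl)
    fix s''
    assume new: "(\<forall>X\<subseteq>{..<k}. weights s'' ''F'' (v * 2 ^ k + set_encode X) = partition_min (h v) X) \<and>
      (\<forall>c<v * 2 ^ k. weights s'' ''F'' c = weights s' ''F'' c)"
    then show "table (Suc v) k (\<lambda>v. partition_min (h v)) (weights s'' ''F'')"
      using 5(2) unfolding table_def by (simp add: less_Suc_eq mult_add_less set_encode_less)
  qed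
next
  case 6
  have "n * 1 \<le> n * 3 ^ k" by (intro mult_left_mono) auto
  then have "9 + n * 12 \<le> 30 * (n * 3 ^ k)" using n by linarith
  then show ?case by (simp add: algebra_simps)
qed (auto simp: table_def)

section \<open>Minimising over arcs\<close>

definition best_arc :: com where
  "best_arc = For_loop ''u'' (scalar ''n'') (Relax ''acc'' (Const 0)
     (WAdd (WCell ''E'' (NAdd (NCell ''rowE'' (scalar ''v'')) (scalar ''u'')))
       (WCell ''F'' (NAdd (NCell ''rowF'' (scalar ''u'')) (scalar ''m'')))))"

lemma writes_best_arc [simp]:
  "nat_writes best_arc = {''u''}" "weight_writes best_arc = {''acc''}"
  by (auto simp: best_arc_def)

lemma INF_lessThan_Suc:
  fixes f :: "nat \<Rightarrow> ennreal"
  shows "(INF i\<in>{..<Suc m}. f i) = min (INF i\<in>{..<m}. f i) (f m)"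
  by (simp add: lessThan_Suc inf_min min.commute)

lemma runs_best_arc:
  assumes p: "prepared n k s" and v: "nats s ''v'' 0 = v" "v < n" and m: "nats s ''m'' 0 = m"
    and acc: "weights s ''acc'' 0 = \<infinity>" and n: "n \<ge> 1"
  shows "runs best_arc s (70 * n) (\<lambda>s'. weights s' ''acc'' 0 =
    (INF u\<in>{..<n}. weights s ''E'' (v * n + u) + weights s ''F'' (u * 2 ^ k + m)) \<and> frame best_arc s s')"
  unfolding best_arc_def
proof (rule runs_For_const[where N = n and B = 40 and I = "\<lambda>i s'. weights s' ''acc'' 0 =
    (INF u\<in>{..<i}. weights s ''E'' (v * n + u) + weights s ''F'' (u * 2 ^ k + m))"], goal_cases)
  case (2 s')
  then have "nats s' ''n'' = nats s ''n''" by (rule frame_nats) simp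
  then show ?case using p by (simp add: prepared_def)
next
  case (5 i s')
  have p': "prepared n k s'" using prepared_frame[OF p 5(4)] by simp
  have "nats s' ''v'' 0 = v" "nats s' ''m'' 0 = m"
    using frame_nats[OF 5(4), of "''v''"] frame_nats[OF 5(4), of "''m''"] v m by simp_all
  moreover have "nats s' ''rowE'' v = v * n" "nats s' ''rowF'' i = i * 2 ^ k"
    using p' 5(1) v(2) by (simp_all add: prepared_def)
  moreover have "weights s' ''E'' = weights s ''E''" "weights s' ''F'' = weights s ''F''"
    using frame_weights[OF 5(4), of "''E''"] frame_weights[OF 5(4), of "''F''"] by simp_all
  ultimately show ?case using 5(2,3) by (intro runs_Relax) (simp_all add: INF_lessThan_Suc)
qed (use n acc in auto)

definition branch_row :: com where
  "branch_row = For_loop ''m'' (scalar ''K'') (Seq (WAssign ''acc'' (Const 0) WInf) (Seq best_arc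
     (WAssign ''H'' (NAdd (NCell ''rowF'' (scalar ''v'')) (scalar ''m'')) (WCell ''acc'' (Const 0)))))"

lemma writes_branch_row [simp]:
  "nat_writes branch_row = {''m'', ''u''}" "weight_writes branch_row = {''acc'', ''H''}"
  by (auto simp: branch_row_def)

lemma runs_branch_row:
  assumes p: "prepared n k s" and v: "nats s ''v'' 0 = v" "v < n" and n: "n \<ge> 1"
  shows "runs branch_row s (120 * (n * 2 ^ k)) (\<lambda>s'.
    (\<forall>m<2 ^ k. weights s' ''H'' (v * 2 ^ k + m) =
      (INF u\<in>{..<n}. weights s ''E'' (v * n + u) + weights s ''F'' (u * 2 ^ k + m))) \<and>
    (\<forall>c<v * 2 ^ k. weights s' ''H'' c = weights s ''H'' c))"
proof -
  let ?g = "\<lambda>m. INF u\<in>{..<n}. weights s ''E'' (v * n + u) + weights s ''F'' (u * 2 ^ k + m)"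
  let ?I = "\<lambda>i s'. (\<forall>m<i. weights s' ''H'' (v * 2 ^ k + m) = ?g m) \<and>
    (\<forall>c<v * 2 ^ k. weights s' ''H'' c = weights s ''H'' c)"
  have "runs branch_row s (120 * (n * 2 ^ k)) (\<lambda>s'. ?I (2 ^ k) s' \<and> frame branch_row s s')"
    unfolding branch_row_def
  proof (rule runs_For_const[where I = ?I and N = "2 ^ k" and B = "70 * n + 12"], goal_cases)
    case (2 s')
    then have "nats s' ''K'' = nats s ''K''" by (rule frame_nats) simp
    then show ?case using p by (simp add: prepared_def)
  next
    case (5 m s')
    note fr = 5(4)
    have p': "prepared n k s'" using prepared_frame[OF p fr] by simp
    have v': "nats s' ''v'' 0 = v" using frame_nats[OF fr, of "''v''"] v by simp
    have EF: "weights s' ''E'' = weights s ''E''" "weights s' ''F'' = weights s ''F''"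
      using frame_weights[OF fr, of "''E''"] frame_weights[OF fr, of "''F''"] by simp_all
    let ?s1 = "wupd ''acc'' 0 \<infinity> s'"
    have p1: "prepared n k ?s1" using p' by (simp add: prepared_def)
    have best: "runs best_arc ?s1 (70 * n) (\<lambda>s2. weights s2 ''acc'' 0 = ?g m \<and> frame best_arc ?s1 s2)"
      using runs_best_arc[OF p1 _ v(2) _ _ n, of m] v' EF 5(3) by simp
    have store: "runs (WAssign ''H'' (NAdd (NCell ''rowF'' (scalar ''v'')) (scalar ''m'')) (WCell ''acc'' (Const 0)))
        s2 9 (?I (Suc m))"
      if s2: "weights s2 ''acc'' 0 = ?g m \<and> frame best_arc ?s1 s2" for s2
    proof -
      have "prepared n k s2" using prepared_frame[OF p1, of best_arc s2] s2 by simp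
      then have "nats s2 ''rowF'' v = v * 2 ^ k" using v(2) by (simp add: prepared_def)
      moreover have "nats s2 ''v'' 0 = v" "nats s2 ''m'' 0 = m" "weights s2 ''H'' = weights s' ''H''"
        using frame_nats[of best_arc ?s1 s2 "''v''"] frame_nats[of best_arc ?s1 s2 "''m''"]
          frame_weights[of best_arc ?s1 s2 "''H''"] s2 v' 5(3) by simp_all
      ultimately show ?thesis using 5(2) s2 by (intro runs_WAssignI) (auto simp: less_Suc_eq)
    qed
    show ?case
      by (rule runs_Seq_mono[OF runs_WAssign[where Q = "\<lambda>s1. s1 = ?s1"]], simp, hypsubst,
          rule runs_Seq_mono[OF best store], assumption, rule order_refl, simp)
  next
    case 6
    have "(2::nat) ^ k * 1 \<le> 2 ^ k * n" using n by (intro mult_left_mono) auto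
    moreover have "(1::nat) \<le> 2 ^ k" by simp
    ultimately have "9 + 2 ^ k * 24 \<le> 50 * (2 ^ k * n)" by linarith
    then show ?case by (simp add: algebra_simps)
  qed auto
  then show ?thesis by (rule runs_mono) auto
qed

text \<open>\<open>F\<close> is only read and \<open>H\<close> only written, so the branch values of
  one depth can be overwritten by those of the next.\<close>

definition branch :: com where
  "branch = For_loop ''v'' (scalar ''n'') branch_row"

lemma writes_branch [simp]:
  "nat_writes branch = {''v'', ''m'', ''u''}" "weight_writes branch = {''acc'', ''H''}"
  by (auto simp: branch_def)

lemma runs_branch:
  assumes p: "prepared n k s" and F: "table n k f (weights s ''F'')" and n: "n \<ge> 1"
  shows "runs branch s (150 * (n * n * 2 ^ k))
    (\<lambda>s'. table n k (\<lambda>v X. INF u\<in>{..<n}. weights s ''E'' (v * n + u) + f u X) (weights s' ''H'') \<and> frame branch s s')"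
  unfolding branch_def
proof (rule runs_For_const[where N = n and B = "120 * (n * 2 ^ k)" and
    I = "\<lambda>v s'. table v k (\<lambda>v X. INF u\<in>{..<n}. weights s ''E'' (v * n + u) + f u X) (weights s' ''H'')"], goal_cases)
  case (2 s')
  then have "nats s' ''n'' = nats s ''n''" by (rule frame_nats) simp
  then show ?case using p by (simp add: prepared_def)
next
  case (5 v s')
  note fr = 5(4)
  have p': "prepared n k s'" using prepared_frame[OF p 5(4)] by simp
  have EF: "weights s' ''E'' = weights s ''E''" "weights s' ''F'' = weights s ''F''"
    using frame_weights[OF fr, of "''E''"] frame_weights[OF fr, of "''F''"] by simp_all
  show ?case
  proof (rule runs_mono[OF runs_branch_row[OF p' 5(3,1) n]], rule order_refl)
    fix s''
    assume new: "(\<forall>m<2 ^ k. weights s'' ''H'' (v * 2 ^ k + m) =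
        (INF u\<in>{..<n}. weights s' ''E'' (v * n + u) + weights s' ''F'' (u * 2 ^ k + m))) \<and>
      (\<forall>c<v * 2 ^ k. weights s'' ''H'' c = weights s' ''H'' c)"
    have "weights s'' ''H'' (v * 2 ^ k + set_encode X) = (INF u\<in>{..<n}. weights s ''E'' (v * n + u) + f u X)"
      if X: "X \<subseteq> {..<k}" for X
    proof -
      have "weights s'' ''H'' (v * 2 ^ k + set_encode X) =
          (INF u\<in>{..<n}. weights s ''E'' (v * n + u) + weights s ''F'' (u * 2 ^ k + set_encode X))"
        using new set_encode_less[OF X] by (simp add: EF)
      also have "\<dots> = (INF u\<in>{..<n}. weights s ''E'' (v * n + u) + f u X)"
        using F X by (intro INF_cong) (auto simp: table_def)
      finally show ?thesis .
    qed
    then show "table (Suc v) k (\<lambda>v X. INF u\<in>{..<n}. weights s ''E'' (v * n + u) + f u X) (weights s'' ''H'')"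
      using 5(2) new unfolding table_def by (simp add: less_Suc_eq mult_add_less set_encode_less)
  qed
next
  case 6
  have "n * 1 \<le> n * (n * 2 ^ k)" using n by (intro mult_left_mono) auto
  then have "9 + n * 12 \<le> 30 * (n * (n * 2 ^ k))" using n by linarith
  then show ?case by (simp add: algebra_simps)
qed (auto simp: table_def)

section \<open>Tabulating mask pairs, powers and row offsets\<close>

definition triple_pairs :: com where
  "triple_pairs = For_loop ''i'' (scalar ''L'')
     (Seq (NAssign ''P'' (NAdd (scalar ''L'') (scalar ''i'')) (NAdd (NCell ''P'' (scalar ''i'')) (scalar ''K'')))
     (Seq (NAssign ''Q'' (NAdd (scalar ''L'') (scalar ''i'')) (NCell ''Q'' (scalar ''i'')))
     (Seq (NAssign ''P'' (NAdd (NAdd (scalar ''L'') (scalar ''L'')) (scalar ''i'')) (NCell ''P'' (scalar ''i'')))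
       (NAssign ''Q'' (NAdd (NAdd (scalar ''L'') (scalar ''L'')) (scalar ''i''))
         (NAdd (NCell ''Q'' (scalar ''i'')) (scalar ''K''))))))"

lemma writes_triple_pairs [simp]:
  "nat_writes triple_pairs = {''i'', ''P'', ''Q''}" "weight_writes triple_pairs = {}"
  by (auto simp: triple_pairs_def)

text \<open>Applied with \<open>L = 3 ^ j\<close> and \<open>K = 2 ^ j\<close>, this is the step of
  \<open>mask_pairs_Suc\<close>. The copies go behind the first \<open>L\<close> entries, which keep
  their contents.\<close>

lemma runs_triple_pairs:
  assumes L: "nats s ''L'' 0 = L" "L \<ge> 1"
  shows "runs triple_pairs s (70 * L) (\<lambda>s'.
    (\<forall>i<L. nats s' ''P'' (L + i) = nats s ''P'' i + nats s ''K'' 0 \<and> nats s' ''Q'' (L + i) = nats s ''Q'' i \<and>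
      nats s' ''P'' (L + L + i) = nats s ''P'' i \<and> nats s' ''Q'' (L + L + i) = nats s ''Q'' i + nats s ''K'' 0) \<and>
    (\<forall>i<L. nats s' ''P'' i = nats s ''P'' i \<and> nats s' ''Q'' i = nats s ''Q'' i) \<and> frame triple_pairs s s')"
proof -
  let ?I = "\<lambda>m s'.
    (\<forall>i<m. nats s' ''P'' (L + i) = nats s ''P'' i + nats s ''K'' 0 \<and> nats s' ''Q'' (L + i) = nats s ''Q'' i \<and>
      nats s' ''P'' (L + L + i) = nats s ''P'' i \<and> nats s' ''Q'' (L + L + i) = nats s ''Q'' i + nats s ''K'' 0) \<and>
    (\<forall>i<L. nats s' ''P'' i = nats s ''P'' i \<and> nats s' ''Q'' i = nats s ''Q'' i)"
  have "runs triple_pairs s (70 * L) (\<lambda>s'. ?I L s' \<and> frame triple_pairs s s')"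
    unfolding triple_pairs_def
  proof (rule runs_For_const[where I = ?I and N = L and B = 48], goal_cases)
    case (2 s')
    then have "nats s' ''L'' = nats s ''L''" by (rule frame_nats) simp
    then show ?case using L by simp
  next
    case (5 i s')
    have eqs: "nats s' ''L'' 0 = L" "nats s' ''K'' 0 = nats s ''K'' 0" "nats s' ''i'' 0 = i"
      using frame_nats[OF 5(4), of "''L''"] frame_nats[OF 5(4), of "''K''"] L 5(3) by simp_all
    have PQ: "nats s' ''P'' i = nats s ''P'' i" "nats s' ''Q'' i = nats s ''Q'' i" using 5(1,2) by auto
    show ?case
      by (rule runs_NAssign_Seq, rule runs_NAssign_Seq, rule runs_NAssign_Seq, rule runs_NAssign)
        (use 5(1,2) in \<open>auto simp: eqs PQ less_Suc_eq\<close>)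
  qed (use L in auto)
  then show ?thesis by simp
qed

text \<open>\<open>K\<close> and \<open>L\<close> run through the powers of \<open>2\<close> and
  \<open>3\<close> by doubling and tripling; \<open>K\<close> is left at \<open>2 ^ k\<close>, the
  row length of the tables \<open>F\<close> and \<open>H\<close>.\<close>

definition prepare_pairs :: com where
  "prepare_pairs =
     Seq (NAssign ''L'' (Const 0) (Const 1)) (Seq (NAssign ''K'' (Const 0) (Const 1))
     (Seq (NAssign ''P'' (Const 0) (Const 0)) (Seq (NAssign ''Q'' (Const 0) (Const 0))
     (For_loop ''j'' (scalar ''k'')
       (Seq (NAssign ''pow2'' (scalar ''j'') (scalar ''K''))
       (Seq (NAssign ''pow3'' (scalar ''j'') (scalar ''L''))
       (Seq triple_pairs
       (Seq (NAssign ''L'' (Const 0) (NAdd (NAdd (scalar ''L'') (scalar ''L'')) (scalar ''L'')))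
         (NAssign ''K'' (Const 0) (NAdd (scalar ''K'') (scalar ''K'')))))))))))"


lemma writes_prepare_pairs [simp]:
  "nat_writes prepare_pairs = {''L'', ''K'', ''P'', ''Q'', ''j'', ''pow2'', ''pow3'', ''i''}"
  "weight_writes prepare_pairs = {}"
  by (auto simp: prepare_pairs_def)

lemma runs_prepare_pairs:
  assumes k: "nats s ''k'' 0 = k"
  shows "runs prepare_pairs s (140 * 3 ^ k) (\<lambda>s'. nats s' ''K'' 0 = 2 ^ k \<and>
    (\<forall>j<k. nats s' ''pow2'' j = 2 ^ j \<and> nats s' ''pow3'' j = 3 ^ j \<and>
       mask_pairs j (nats s' ''P'') (nats s' ''Q'')))"
proof -
  let ?body = "Seq (NAssign ''pow2'' (scalar ''j'') (scalar ''K''))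
       (Seq (NAssign ''pow3'' (scalar ''j'') (scalar ''L''))
       (Seq triple_pairs
       (Seq (NAssign ''L'' (Const 0) (NAdd (NAdd (scalar ''L'') (scalar ''L'')) (scalar ''L'')))
         (NAssign ''K'' (Const 0) (NAdd (scalar ''K'') (scalar ''K''))))))"
  let ?I = "\<lambda>j s'. nats s' ''L'' 0 = 3 ^ j \<and> nats s' ''K'' 0 = 2 ^ j \<and>
    (\<forall>j'<j. nats s' ''pow2'' j' = 2 ^ j' \<and> nats s' ''pow3'' j' = 3 ^ j') \<and>
    (\<forall>j'\<le>j. mask_pairs j' (nats s' ''P'') (nats s' ''Q''))"
  define s0 where "s0 = nupd ''Q'' 0 0 (nupd ''P'' 0 0 (nupd ''K'' 0 1 (nupd ''L'' 0 1 s)))"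
  have "runs (For_loop ''j'' (scalar ''k'') ?body) s0
     ((\<Sum>j<k. (70 * 3 ^ j + 27) + (ncost (scalar ''k'') + 10)) + (ncost (scalar ''k'') + 7))
     (\<lambda>s'. ?I k s' \<and> frame (For_loop ''j'' (scalar ''k'') ?body) s0 s')"
  proof (rule runs_For[where I = ?I and N = k and B = "\<lambda>j. 70 * 3 ^ j + 27"], goal_cases)
    case (2 s')
    then have "nats s' ''k'' = nats s0 ''k''" by (rule frame_nats) simp
    then show ?case using k by (simp add: s0_def)
  next
    case 4
    then show ?case by (simp add: s0_def mask_pairs_0)
  next
    case (5 j s')
    note I = 5(2)
    define s1 where "s1 = nupd ''pow3'' j (3 ^ j) (nupd ''pow2'' j (2 ^ j) s')"
    have s1: "nats s1 ''L'' 0 = 3 ^ j" "(3::nat) ^ j \<ge> 1" using I by (simp_all add: s1_def)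
    have tail: "runs (Seq (NAssign ''L'' (Const 0) (NAdd (NAdd (scalar ''L'') (scalar ''L'')) (scalar ''L'')))
         (NAssign ''K'' (Const 0) (NAdd (scalar ''K'') (scalar ''K'')))) s2 17 (?I (Suc j))"
      if s2: "(\<forall>i<3 ^ j. nats s2 ''P'' (3 ^ j + i) = nats s1 ''P'' i + nats s1 ''K'' 0 \<and>
          nats s2 ''Q'' (3 ^ j + i) = nats s1 ''Q'' i \<and>
          nats s2 ''P'' (3 ^ j + 3 ^ j + i) = nats s1 ''P'' i \<and>
          nats s2 ''Q'' (3 ^ j + 3 ^ j + i) = nats s1 ''Q'' i + nats s1 ''K'' 0) \<and>
        (\<forall>i<3 ^ j. nats s2 ''P'' i = nats s1 ''P'' i \<and> nats s2 ''Q'' i = nats s1 ''Q'' i) \<and>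
        frame triple_pairs s1 s2" for s2
    proof -
      have fr: "nats s2 a = nats s1 a" if "a \<notin> {''i'', ''P'', ''Q''}" for a
        using s2 that frame_nats[of triple_pairs s1 s2 a] by simp
      have PQ: "nats s1 ''P'' = nats s' ''P''" "nats s1 ''Q'' = nats s' ''Q''" "nats s1 ''K'' 0 = 2 ^ j"
        using I by (simp_all add: s1_def)
      \<comment> \<open>The pairs of every earlier stage form a prefix of the first
        \<open>3 ^ j\<close> entries, which the tripling leaves alone.\<close>
      have old: "mask_pairs j' (nats s2 ''P'') (nats s2 ''Q'')" if "j' \<le> j" for j'
      proof (rule mask_pairs_cong)
        show "mask_pairs j' (nats s' ''P'') (nats s' ''Q'')" using I that by blast
        fix i :: nat assume "i < 3 ^ j'"
        also have "(3::nat) ^ j' \<le> 3 ^ j" using that by (intro power_increasing) auto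
        finally show "nats s2 ''P'' i = nats s' ''P'' i \<and> nats s2 ''Q'' i = nats s' ''Q'' i"
          using s2 PQ by simp
      qed
      have "mask_pairs (Suc j) (nats s2 ''P'') (nats s2 ''Q'')"
        using I s2 unfolding PQ by (intro mask_pairs_Suc[of j "nats s' ''P''" "nats s' ''Q''"]) auto
      then have masks: "\<forall>j'\<le>Suc j. mask_pairs j' (nats s2 ''P'') (nats s2 ''Q'')"
        using old by (auto simp: le_Suc_eq)
      have "nats s2 ''L'' 0 = 3 ^ j" "nats s2 ''K'' 0 = 2 ^ j"
        "\<forall>j'<Suc j. nats s2 ''pow2'' j' = 2 ^ j' \<and> nats s2 ''pow3'' j' = 3 ^ j'"
        using I fr[of "''L''"] fr[of "''K''"] fr[of "''pow2''"] fr[of "''pow3''"]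
        by (auto simp: s1_def less_Suc_eq)
      then show ?thesis using masks
        by (intro runs_NAssign_Seq[OF runs_NAssign]) simp_all
    qed
    have "runs (Seq triple_pairs (Seq (NAssign ''L'' (Const 0) (NAdd (NAdd (scalar ''L'') (scalar ''L'')) (scalar ''L'')))
         (NAssign ''K'' (Const 0) (NAdd (scalar ''K'') (scalar ''K''))))) s1 (70 * 3 ^ j + 17) (?I (Suc j))"
      by (rule runs_Seq_mono[OF runs_triple_pairs[OF s1] tail]) auto
    moreover have "s1 = nupd ''pow3'' (nval (scalar ''j'') (nupd ''pow2'' j (2 ^ j) s'))
        (nval (scalar ''L'') (nupd ''pow2'' j (2 ^ j) s'))
        (nupd ''pow2'' (nval (scalar ''j'') s') (nval (scalar ''K'') s') s')"
      using I 5(3) by (simp add: s1_def)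
    ultimately show ?case using I 5(3)
      by (intro runs_NAssign_Seq[where B = "70 * 3 ^ j + 22"] runs_NAssign_Seq[where B = "70 * 3 ^ j + 17"]) simp_all
  qed auto
  then have loop: "runs (For_loop ''j'' (scalar ''k'') ?body) s0 (120 * 3 ^ k) (?I k)"
  proof (rule runs_mono)
    have "(\<Sum>j<k. (70 * 3 ^ j + 27) + (ncost (scalar ''k'') + 10)) + (ncost (scalar ''k'') + 7)
      \<le> (\<Sum>j<k. 3 ^ j * 120) + (120::nat)"
    proof (intro add_mono sum_mono)
      fix j
      have "(1::nat) \<le> 3 ^ j" by simp
      then have "40 \<le> 50 * (3::nat) ^ j" by linarith
      then show "70 * 3 ^ j + 27 + (ncost (scalar ''k'') + 10) \<le> 3 ^ j * (120::nat)" by simp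
    qed simp
    then show "(\<Sum>j<k. (70 * 3 ^ j + 27) + (ncost (scalar ''k'') + 10)) + (ncost (scalar ''k'') + 7)
      \<le> 120 * 3 ^ k" using sum_power_less[of 120 k] by linarith
  qed auto
  have "runs prepare_pairs s (12 + 120 * 3 ^ k) (?I k)"
    unfolding prepare_pairs_def
    by (rule runs_NAssign_Seq, rule runs_NAssign_Seq, rule runs_NAssign_Seq, rule runs_NAssign_Seq,
        simp only: nval.simps, rule loop[unfolded s0_def], (rule order_refl)+) simp
  then show ?thesis
  proof (rule runs_mono)
    have "(1::nat) \<le> 3 ^ k" by simp
    then show "12 + 120 * 3 ^ k \<le> 140 * (3::nat) ^ k" by linarith
  qed auto
qed

text \<open>\<open>x\<close> and \<open>y\<close> accumulate the multiples of \<open>n\<close> and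
  \<open>K\<close>. As \<open>K\<close> must already be the full power, this comes after
  \<open>prepare_pairs\<close>.\<close>

definition prepare_rows :: com where
  "prepare_rows =
     Seq (NAssign ''x'' (Const 0) (Const 0)) (Seq (NAssign ''y'' (Const 0) (Const 0))
     (For_loop ''v'' (scalar ''n'')
       (Seq (NAssign ''rowE'' (scalar ''v'') (scalar ''x''))
       (Seq (NAssign ''rowF'' (scalar ''v'') (scalar ''y''))
       (Seq (NAssign ''x'' (Const 0) (NAdd (scalar ''x'') (scalar ''n'')))
         (NAssign ''y'' (Const 0) (NAdd (scalar ''y'') (scalar ''K''))))))))"

lemma writes_prepare_rows [simp]:
  "nat_writes prepare_rows = {''x'', ''y'', ''v'', ''rowE'', ''rowF''}"
  "weight_writes prepare_rows = {}"
  by (auto simp: prepare_rows_def)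

lemma runs_prepare_rows:
  assumes n: "nats s ''n'' 0 = n" "n \<ge> 1" and K: "nats s ''K'' 0 = K"
  shows "runs prepare_rows s (70 * n) (\<lambda>s'. \<forall>v<n. nats s' ''rowE'' v = v * n \<and> nats s' ''rowF'' v = v * K)"
proof -
  let ?body = "Seq (NAssign ''rowE'' (scalar ''v'') (scalar ''x''))
       (Seq (NAssign ''rowF'' (scalar ''v'') (scalar ''y''))
       (Seq (NAssign ''x'' (Const 0) (NAdd (scalar ''x'') (scalar ''n'')))
         (NAssign ''y'' (Const 0) (NAdd (scalar ''y'') (scalar ''K'')))))"
  let ?I = "\<lambda>i s'. (\<forall>v<i. nats s' ''rowE'' v = v * n \<and> nats s' ''rowF'' v = v * K) \<and>
    nats s' ''x'' 0 = i * n \<and> nats s' ''y'' 0 = i * K"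
  let ?s0 = "nupd ''y'' 0 0 (nupd ''x'' 0 0 s)"
  have loop: "runs (For_loop ''v'' (scalar ''n'') ?body) ?s0 (60 * n)
      (\<lambda>s'. ?I n s' \<and> frame (For_loop ''v'' (scalar ''n'') ?body) ?s0 s')"
  proof (rule runs_For_const[where I = ?I and N = n and B = 24], goal_cases)
    case (2 s')
    then have "nats s' ''n'' = nats ?s0 ''n''" by (rule frame_nats) simp
    then show ?case using n by simp
  next
    case (5 i s')
    have "nats s' ''n'' 0 = n" "nats s' ''K'' 0 = K"
      using frame_nats[OF 5(4), of "''n''"] frame_nats[OF 5(4), of "''K''"] n K by simp_all
    then show ?case
      by (intro runs_mono[OF runs_NAssign_Seq[OF runs_NAssign_Seq[OF runs_NAssign_Seq[OF runs_NAssign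
        order_refl] order_refl] order_refl]]) (use 5(1-3) in \<open>auto simp: less_Suc_eq\<close>)
  qed (use n in auto)
  show ?thesis unfolding prepare_rows_def
    by (rule runs_mono, rule runs_NAssign_Seq, rule runs_NAssign_Seq, simp only: nval.simps, rule loop,
        (rule order_refl)+) (use n in auto)
qed

definition prepare :: com where
  "prepare = Seq prepare_pairs prepare_rows"

lemma writes_prepare [simp]:
  "nat_writes prepare = {''L'', ''K'', ''P'', ''Q'', ''j'', ''pow2'', ''pow3'', ''i'', ''x'', ''y'', ''v'', ''rowE'', ''rowF''}"
  "weight_writes prepare = {}"
  by (auto simp: prepare_def)

lemma runs_prepare:
  assumes n: "nats s ''n'' 0 = n" "n \<ge> 1" and k: "nats s ''k'' 0 = k"
  shows "runs prepare s (210 * (n * 3 ^ k)) (\<lambda>s'. prepared n k s' \<and> frame prepare s s')"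
proof (rule runs_frame)
  have rows: "runs prepare_rows s1 (70 * n) (prepared n k)"
    if s1: "(nats s1 ''K'' 0 = 2 ^ k \<and>
      (\<forall>j<k. nats s1 ''pow2'' j = 2 ^ j \<and> nats s1 ''pow3'' j = 3 ^ j \<and>
         mask_pairs j (nats s1 ''P'') (nats s1 ''Q''))) \<and> frame prepare_pairs s s1" for s1
  proof -
    have "nats s1 ''n'' 0 = n" "nats s1 ''k'' 0 = k"
      using frame_nats[of prepare_pairs s s1 "''n''"] frame_nats[of prepare_pairs s s1 "''k''"] s1 n k
      by simp_all
    moreover from this(1) s1 have "runs prepare_rows s1 (70 * n) (\<lambda>s'.
       (\<forall>v<n. nats s' ''rowE'' v = v * n \<and> nats s' ''rowF'' v = v * 2 ^ k) \<and> frame prepare_rows s1 s')"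
      using n by (intro runs_frame runs_prepare_rows) auto
    ultimately show ?thesis
    proof (elim runs_mono, goal_cases)
      case (2 s2)
      have "\<forall>a\<in>{''n'', ''k'', ''K'', ''pow2'', ''pow3'', ''P'', ''Q''}. nats s2 a = nats s1 a"
        using 2 frame_nats[of prepare_rows s1 s2] by simp
      then show ?case using 2 s1 by (simp add: prepared_def)
    qed simp
  qed
  have "(1::nat) \<le> 3 ^ k" by simp
  then have "n * 1 \<le> n * 3 ^ k" "1 * 3 ^ k \<le> n * 3 ^ k" using n by (intro mult_mono; simp)+
  then have le: "140 * 3 ^ k + 70 * n \<le> 210 * (n * 3 ^ k)" by linarith
  show "runs prepare s (210 * (n * 3 ^ k)) (prepared n k)"
    unfolding prepare_def by (rule runs_Seq_mono[OF runs_frame[OF runs_prepare_pairs[OF k]] rows le])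
qed

section \<open>The initial table, the rounds and the complete program\<close>

lemma mult_add_eq_iff:
  fixes K :: nat
  assumes "x < K" "y < K"
  shows "v * K + x = w * K + y \<longleftrightarrow> v = w \<and> x = y"
proof
  assume eq: "v * K + x = w * K + y"
  have "(v * K + x) div K = (w * K + y) div K" by (simp only: eq)
  then have "v = w" using assms by simp
  then show "v = w \<and> x = y" using eq by simp
qed simp

text \<open>The base case of the recurrence: \<open>2 ^ j\<close> is the mask of the singleton of
  \<open>j\<close>, and the row is that of the vertex carrying this terminal.\<close>

definition start_branches :: com where
  "start_branches = Seq (For_loop ''v'' (scalar ''n'') (fill_row ''H''))
     (For_loop ''j'' (scalar ''k'')
       (WAssign ''H'' (NAdd (NCell ''rowF'' (NCell ''T'' (scalar ''j''))) (NCell ''pow2'' (scalar ''j''))) WZero))"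

lemma writes_start_branches [simp]:
  "nat_writes start_branches = {''v'', ''m'', ''j''}" "weight_writes start_branches = {''H''}"
  by (auto simp: start_branches_def)

lemma runs_start_branches:
  assumes p: "prepared n k s" and n: "n \<ge> 1" and T: "\<And>j. j < k \<Longrightarrow> nats s ''T'' j < n"
  shows "runs start_branches s (150 * (n * 3 ^ k)) (\<lambda>s'.
    table n k (\<lambda>v X. if \<exists>j. X = {j} \<and> nats s ''T'' j = v then 0 else \<infinity>) (weights s' ''H'') \<and>
    frame start_branches s s')"
proof (rule runs_frame)
  let ?I1 = "\<lambda>v s'. table v k (\<lambda>_ _. \<infinity>) (weights s' ''H'')"
  let ?c1 = "For_loop ''v'' (scalar ''n'') (fill_row ''H'')"
  let ?c2 = "For_loop ''j'' (scalar ''k'')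
       (WAssign ''H'' (NAdd (NCell ''rowF'' (NCell ''T'' (scalar ''j''))) (NCell ''pow2'' (scalar ''j''))) WZero)"
  have first: "runs ?c1 s (70 * (n * 2 ^ k)) (\<lambda>s'. ?I1 n s' \<and> frame ?c1 s s')"
  proof (rule runs_For_const[where I = ?I1 and N = n and B = "40 * 2 ^ k"], goal_cases)
    case (2 s')
    then have "nats s' ''n'' = nats s ''n''" by (rule frame_nats) simp
    then show ?case using p by (simp add: prepared_def)
  next
    case (5 v s')
    have p': "prepared n k s'" using prepared_frame[OF p 5(4)] by simp
    show ?case
    proof (rule runs_mono[OF runs_fill_row[OF p' 5(3,1)]], rule order_refl)
      fix s''
      assume "weights s'' ''H'' = (\<lambda>c. if v * 2 ^ k \<le> c \<and> c < v * 2 ^ k + 2 ^ k then \<infinity> else weights s' ''H'' c) \<and>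
        frame (fill_row ''H'') s' s''"
      then show "?I1 (Suc v) s''" using 5(2) unfolding table_def
        by (simp add: less_Suc_eq mult_add_less set_encode_less)
    qed
  next
    case 6
    have "n * 1 \<le> n * 2 ^ k" by (intro mult_left_mono) auto
    then have "9 + n * 12 \<le> 30 * (n * 2 ^ k)" using n by linarith
    then show ?case by (simp add: algebra_simps)
  qed (auto simp: table_def)
  let ?I2 = "\<lambda>i s'. table n k (\<lambda>v X. if \<exists>j<i. X = {j} \<and> nats s ''T'' j = v then 0 else \<infinity>) (weights s' ''H'')"
  have second: "runs ?c2 s1 (30 * k + 9) (\<lambda>s'. ?I2 k s' \<and> frame ?c2 s1 s')"
    if s1: "?I1 n s1 \<and> frame ?c1 s s1" for s1
  proof (rule runs_For_const[where I = ?I2 and N = k and B = 12], goal_cases)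
    case (2 s')
    then have "nats s' ''k'' = nats s1 ''k''" by (rule frame_nats) simp
    also have "\<dots> = nats s ''k''" using frame_nats[of ?c1 s s1 "''k''"] s1 by simp
    finally show ?case using p by (simp add: prepared_def)
  next
    case 4
    then show ?case using s1 by simp
  next
    case (5 i s')
    have p1: "prepared n k s1" using prepared_frame[OF p, of ?c1 s1] s1 by simp
    have p': "prepared n k s'" using prepared_frame[OF p1 5(4)] by simp
    have T': "nats s' ''T'' = nats s ''T''"
      using frame_nats[OF 5(4), of "''T''"] frame_nats[of ?c1 s s1 "''T''"] s1 by simp
    have idx: "nats s' ''rowF'' (nats s ''T'' i) = nats s ''T'' i * 2 ^ k" "nats s' ''pow2'' i = 2 ^ i"
      using p' T[OF 5(1)] 5(1) by (simp_all add: prepared_def)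
    \<comment> \<open>Row and mask can be recovered from an address, so each write affects a single
      entry of the table.\<close>
    have upd: "v * 2 ^ k + set_encode X = nats s ''T'' i * 2 ^ k + 2 ^ i \<longleftrightarrow> v = nats s ''T'' i \<and> X = {i}"
      if X: "X \<subseteq> {..<k}" for v X
    proof -
      have "set_encode {i} = 2 ^ i" by (simp add: set_encode_def)
      moreover have "set_encode X = set_encode {i} \<longleftrightarrow> X = {i}"
        using finite_subset[OF X] set_encode_eq[of X "{i}"] by blast
      ultimately show ?thesis
        using mult_add_eq_iff[OF set_encode_less[OF X], of "2 ^ i" v "nats s ''T'' i"] 5(1) by simp
    qed
    have "?I2 (Suc i) (wupd ''H'' (nats s ''T'' i * 2 ^ k + 2 ^ i) 0 s')"
      unfolding table_def
    proof (intro allI impI)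
      fix v X assume v: "v < n" and X: "X \<subseteq> {..<k}"
      have "weights s' ''H'' (v * 2 ^ k + set_encode X) =
          (if \<exists>j<i. X = {j} \<and> nats s ''T'' j = v then 0 else \<infinity>)"
        using 5(2) v X by (simp add: table_def)
      then show "weights (wupd ''H'' (nats s ''T'' i * 2 ^ k + 2 ^ i) 0 s') ''H'' (v * 2 ^ k + set_encode X) =
          (if \<exists>j<Suc i. X = {j} \<and> nats s ''T'' j = v then 0 else \<infinity>)"
        using upd[OF X, of v] by (auto simp: less_Suc_eq)
    qed
    then show ?case by (intro runs_WAssignI) (simp_all add: 5(3) T' idx)
  qed auto
  \<comment> \<open>Pays for the loop over the terminals.\<close>
  have "k < 3 ^ k" by (induction k) auto
  moreover have "1 * 3 ^ k \<le> n * 3 ^ k" "n * 2 ^ k \<le> n * 3 ^ k"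
    using n by (intro mult_mono power_mono; simp)+
  ultimately have le: "70 * (n * 2 ^ k) + (30 * k + 9) \<le> 150 * (n * 3 ^ k)" by linarith
  have "runs start_branches s (150 * (n * 3 ^ k)) (\<lambda>s'. \<exists>s1. ?I2 k s' \<and> frame ?c2 s1 s')"
    unfolding start_branches_def
  proof (rule runs_Seq_mono[OF first _ le])
    fix s1 assume "?I1 n s1 \<and> frame ?c1 s s1"
    from second[OF this] show "runs ?c2 s1 (30 * k + 9) (\<lambda>s'. \<exists>s1. ?I2 k s' \<and> frame ?c2 s1 s')"
      by (rule runs_mono) auto
  qed
  then show "runs start_branches s (150 * (n * 3 ^ k)) (\<lambda>s'.
    table n k (\<lambda>v X. if \<exists>j. X = {j} \<and> nats s ''T'' j = v then 0 else \<infinity>) (weights s' ''H''))"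
  proof (rule runs_mono[OF _ order_refl])
    fix s' assume "\<exists>s1. ?I2 k s' \<and> frame ?c2 s1 s'"
    then have "?I2 k s'" by blast
    moreover have "(\<exists>j<k. X = {j} \<and> nats s ''T'' j = v) \<longleftrightarrow> (\<exists>j. X = {j} \<and> nats s ''T'' j = v)"
      if "X \<subseteq> {..<k}" for X v using that by auto
    ultimately show "table n k (\<lambda>v X. if \<exists>j. X = {j} \<and> nats s ''T'' j = v then 0 else \<infinity>) (weights s' ''H'')"
      unfolding table_def by simp
  qed
qed

text \<open>With truncated subtraction \<open>n - (n - D)\<close> is \<open>min n D\<close>. One
  more round is needed because rounds are counted from \<open>0\<close> and the tree values of depth
  \<open>d\<close> arise in round \<open>d\<close>.\<close>

definition rounds :: com where
  "rounds = For_loop ''d'' (NAdd (NSub (scalar ''n'') (NSub (scalar ''n'') (scalar ''D''))) (Const 1)) (Seq glue branch)"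

lemma writes_rounds [simp]:
  "nat_writes rounds = {''d'', ''v'', ''m'', ''j'', ''i'', ''u''}" "weight_writes rounds = {''F'', ''H'', ''acc''}"
  by (auto simp: rounds_def)

lemma table_cong:
  assumes "table n k f a" "\<And>v X. v < n \<Longrightarrow> X \<subseteq> {..<k} \<Longrightarrow> f v X = g v X"
  shows "table n k g a"
  using assms by (simp add: table_def)

lemma runs_rounds:
  assumes p: "prepared n k s" and n: "n \<ge> 1" and D: "nats s ''D'' 0 = D"
    and \<nu>: "bij_betw \<nu> {..<n} V"
    and E: "\<And>i j. i < n \<Longrightarrow> j < n \<Longrightarrow> weights s ''E'' (i * n + j) = E (\<nu> i) (\<nu> j)"
    and H: "table n k (\<lambda>v. branch_opt V E \<tau> 0 (\<nu> v)) (weights s ''H'')"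
  shows "runs rounds s (1000 * (3 ^ k * n ^ 3))
    (\<lambda>s'. table n k (\<lambda>v. tree_opt V E \<tau> (min n D) (\<nu> v)) (weights s' ''F'') \<and> frame rounds s s')"
proof -
  \<comment> \<open>\<open>H\<close> is one depth ahead of \<open>F\<close>: round \<open>d\<close>
    glues the branches of depth \<open>d\<close> into trees and then forms the branches of depth
    \<open>d + 1\<close>. The guard is there because \<open>F\<close> holds nothing before the first
    round.\<close>
  let ?I = "\<lambda>d s'. table n k (\<lambda>v. branch_opt V E \<tau> d (\<nu> v)) (weights s' ''H'') \<and>
    (d \<ge> 1 \<longrightarrow> table n k (\<lambda>v. tree_opt V E \<tau> (d - 1) (\<nu> v)) (weights s' ''F''))"
  have "runs rounds s (1000 * (3 ^ k * n ^ 3)) (\<lambda>s'. ?I (min n D + 1) s' \<and> frame rounds s s')"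
    unfolding rounds_def
  proof (rule runs_For_const[where I = ?I and N = "min n D + 1" and B = "370 * (n * n * 3 ^ k)"], goal_cases)
    case (2 s')
    have "nats s' ''n'' = nats s ''n''" "nats s' ''D'' = nats s ''D''"
      using frame_nats[OF 2, of "''n''"] frame_nats[OF 2, of "''D''"] by simp_all
    then show ?case using p D by (simp add: prepared_def)
  next
    case (5 d s')
    have p': "prepared n k s'" using prepared_frame[OF p 5(4)] by simp
    have E': "weights s' ''E'' = weights s ''E''" using frame_weights[OF 5(4), of "''E''"] by simp
    have second: "runs branch s1 (150 * (n * n * 2 ^ k)) (?I (Suc d))"
      if s1: "table n k (\<lambda>v. partition_min (branch_opt V E \<tau> d (\<nu> v))) (weights s1 ''F'') \<and> frame glue s' s1" for s1
    proof -
      have p1: "prepared n k s1" using prepared_frame[OF p', of glue s1] s1 by simp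
      have E1: "weights s1 ''E'' = weights s ''E''" using frame_weights[of glue s' s1 "''E''"] s1 E' by simp
      have F: "table n k (\<lambda>v. partition_min (branch_opt V E \<tau> d (\<nu> v))) (weights s1 ''F'')" using s1 by blast
      show ?thesis
      proof (rule runs_mono[OF runs_branch[OF p1 F n]], rule order_refl)
        fix s2
        assume s2: "table n k (\<lambda>v X. INF u\<in>{..<n}. weights s1 ''E'' (v * n + u) +
            partition_min (branch_opt V E \<tau> d (\<nu> u)) X) (weights s2 ''H'') \<and> frame branch s1 s2"
        have "(INF u\<in>{..<n}. weights s1 ''E'' (v * n + u) + partition_min (branch_opt V E \<tau> d (\<nu> u)) X) =
            branch_opt V E \<tau> (Suc d) (\<nu> v) X" if "v < n" for v X
        proof -
          have "branch_opt V E \<tau> (Suc d) (\<nu> v) X =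
              (INF u\<in>\<nu> ` {..<n}. E (\<nu> v) u + partition_min (branch_opt V E \<tau> d u) X)"
            using \<nu> by (simp add: bij_betw_def)
          also have "\<dots> = (INF u\<in>{..<n}. E (\<nu> v) (\<nu> u) + partition_min (branch_opt V E \<tau> d (\<nu> u)) X)"
            by (simp add: image_image)
          also have "\<dots> = (INF u\<in>{..<n}. weights s1 ''E'' (v * n + u) + partition_min (branch_opt V E \<tau> d (\<nu> u)) X)"
            using E that by (intro INF_cong) (simp_all add: E1)
          finally show ?thesis by simp
        qed
        then have "table n k (\<lambda>v. branch_opt V E \<tau> (Suc d) (\<nu> v)) (weights s2 ''H'')"
          using s2 by (blast intro: table_cong)
        moreover have "weights s2 ''F'' = weights s1 ''F''" using frame_weights[of branch s1 s2 "''F''"] s2 by simp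
        ultimately show "?I (Suc d) s2" using F by (simp add: tree_opt_def[abs_def])
      qed
    qed
    have "n * 3 ^ k \<le> n * n * 3 ^ k" "n * n * 2 ^ k \<le> n * n * 3 ^ k"
      using n by (intro mult_mono power_mono; simp)+
    then have "220 * (n * 3 ^ k) + 150 * (n * n * 2 ^ k) \<le> 370 * (n * n * 3 ^ k)" by linarith
    then show ?case using 5(2) by (intro runs_Seq_mono[OF runs_glue[OF p' _ n] second]) auto
  next
    case 6
    let ?X = "n * n * 3 ^ k"
    \<comment> \<open>At most \<open>n + 1\<close> rounds. The \<open>370\<close> adds the budgets
      \<open>220\<close> of \<open>glue\<close> and \<open>150\<close> of \<open>branch\<close>;
      \<open>20\<close> and \<open>17\<close> are the overheads of the loop, whose bound expression
      costs \<open>10\<close>.\<close>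
    have "min n D + 1 \<le> 2 * n" using n by simp
    then have "(min n D + 1) * (370 * ?X + 20) \<le> 2 * n * (370 * ?X + 20)" by (rule mult_right_mono) simp
    also have "\<dots> = 740 * (n * ?X) + 40 * n" by (simp add: algebra_simps)
    finally have "(min n D + 1) * (370 * ?X + 20) \<le> 740 * (n * ?X) + 40 * n" .
    moreover have "n * 1 \<le> n * ?X" using n by (intro mult_left_mono) auto
    moreover have eq: "n * ?X = 3 ^ k * n ^ 3" by (simp add: power3_eq_cube ac_simps)
    ultimately have "(min n D + 1) * (370 * ?X + 20) + 17 \<le> 1000 * (3 ^ k * n ^ 3)"
      using n unfolding eq by linarith
    then show ?case by (simp add: algebra_simps)
  qed (use H in auto)
  then show ?thesis by (rule runs_mono) auto
qed

text \<open>The answer stands in the row of the root at \<open>2 ^ k - 1\<close>, the mask of all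
  terminals; it is infinite exactly in the case of FAIL.\<close>

definition ddcst :: com where
  "ddcst = Seq prepare (Seq start_branches (Seq rounds
     (Seq (WAssign ''opt'' (Const 0)
        (WCell ''F'' (NAdd (NCell ''rowF'' (scalar ''r'')) (NSub (scalar ''K'') (Const 1)))))
     (Cond (WLess (WCell ''opt'' (Const 0)) WInf)
        (NAssign ''fail'' (Const 0) (Const 0))
        (NAssign ''fail'' (Const 0) (Const 1))))))"

lemma runs_CondI:
  assumes "bval b s \<Longrightarrow> runs c s B Q" "\<not> bval b s \<Longrightarrow> runs d s B Q"
  shows "runs (Cond b c d) s (1 + bcost b + B) Q"
proof (cases "bval b s")
  case True
  with assms show ?thesis unfolding runs_def by (meson add_left_mono exec.CondTrue)
next
  case False
  with assms show ?thesis unfolding runs_def by (meson add_left_mono exec.CondFalse)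
qed

lemma runs_ddcst:
  assumes I: "ddcst_instance V E T r D" and enc: "encodes s V E T r D"
  shows "runs ddcst s (2000 * (3 ^ card T * card V ^ 3)) (\<lambda>s'. ddcst_solution V E T r D (result s'))"
proof -
  define n where "n = card V"
  define k where "k = card T"
  obtain \<nu> where \<nu>: "bij_betw \<nu> {..<n} V" and s: "nats s ''n'' 0 = n" "nats s ''k'' 0 = k" "nats s ''D'' 0 = D"
    "nats s ''r'' 0 < n" "\<nu> (nats s ''r'' 0) = r" "\<forall>j<k. nats s ''T'' j < n"
    and \<tau>: "bij_betw (\<lambda>j. \<nu> (nats s ''T'' j)) {..<k} T"
    and E: "\<forall>i<n. \<forall>j<n. weights s ''E'' (i * n + j) = E (\<nu> i) (\<nu> j)"
    using enc unfolding encodes_def n_def k_def by blast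
  define \<tau> where "\<tau> = (\<lambda>j. \<nu> (nats s ''T'' j))"
  define w where "w = tree_opt V E \<tau> (min n D) r {..<k}"
  \<comment> \<open>The root makes the vertex set nonempty; without this, additive overheads could
    not be absorbed into the product bound.\<close>
  have n: "n \<ge> 1" using s(4) by simp
  have sol: "ddcst_solution V E T r D (if w = \<infinity> then None else Some w)"
    unfolding w_def n_def using I \<tau> by (intro ddcst_solution_tree_opt) (auto simp: \<tau>_def)
  have finish: "runs (Seq (WAssign ''opt'' (Const 0)
        (WCell ''F'' (NAdd (NCell ''rowF'' (scalar ''r'')) (NSub (scalar ''K'') (Const 1)))))
     (Cond (WLess (WCell ''opt'' (Const 0)) WInf)
        (NAssign ''fail'' (Const 0) (Const 0))
        (NAssign ''fail'' (Const 0) (Const 1)))) s3 19 (\<lambda>s'. ddcst_solution V E T r D (result s'))"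
    if p: "prepared n k s3" and r: "nats s3 ''r'' 0 = nats s ''r'' 0"
      and F: "table n k (\<lambda>v. tree_opt V E \<tau> (min n D) (\<nu> v)) (weights s3 ''F'')" for s3
  proof -
    have "weights s3 ''F'' (nats s ''r'' 0 * 2 ^ k + (2 ^ k - 1)) = w"
      using F s unfolding table_def w_def by (metis order_refl set_encode_lessThan)
    then have val: "wval (WCell ''F'' (NAdd (NCell ''rowF'' (scalar ''r'')) (NSub (scalar ''K'') (Const 1)))) s3 = w"
      using p r s by (simp add: prepared_def)
    let ?s4 = "wupd ''opt'' 0 w s3"
    have "runs (Cond (WLess (WCell ''opt'' (Const 0)) WInf)
        (NAssign ''fail'' (Const 0) (Const 0))
        (NAssign ''fail'' (Const 0) (Const 1))) ?s4 (1 + bcost (WLess (WCell ''opt'' (Const 0)) WInf) + 3)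
        (\<lambda>s'. ddcst_solution V E T r D (result s'))"
      using sol by (intro runs_CondI runs_NAssignI) (auto simp: result_def less_top split: if_splits)
    then show ?thesis
      by (intro runs_Seq_mono[OF runs_WAssign[where Q = "\<lambda>s'. s' = ?s4"]]) (simp_all only: val nval.simps, simp)
  qed
  have "runs ddcst s (210 * (n * 3 ^ k) + (150 * (n * 3 ^ k) + (1000 * (3 ^ k * n ^ 3) + 19)))
      (\<lambda>s'. ddcst_solution V E T r D (result s'))"
    unfolding ddcst_def
  proof (rule runs_Seq_mono[OF runs_prepare[OF s(1) n s(2)] _ order_refl])
    fix s1 assume s1: "prepared n k s1 \<and> frame prepare s s1"
    have eq1: "nats s1 ''T'' = nats s ''T''" "nats s1 ''D'' = nats s ''D''" "nats s1 ''r'' = nats s ''r''"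
      "weights s1 ''E'' = weights s ''E''"
      using frame_nats[of prepare s s1] frame_weights[of prepare s s1] s1 by simp_all
    have T1: "nats s1 ''T'' j < n" if "j < k" for j using s that by (simp add: eq1)
    show "runs (Seq start_branches (Seq rounds
     (Seq (WAssign ''opt'' (Const 0)
        (WCell ''F'' (NAdd (NCell ''rowF'' (scalar ''r'')) (NSub (scalar ''K'') (Const 1)))))
     (Cond (WLess (WCell ''opt'' (Const 0)) WInf)
        (NAssign ''fail'' (Const 0) (Const 0))
        (NAssign ''fail'' (Const 0) (Const 1)))))) s1 (150 * (n * 3 ^ k) + (1000 * (3 ^ k * n ^ 3) + 19))
      (\<lambda>s'. ddcst_solution V E T r D (result s'))"
    proof (rule runs_Seq_mono[OF runs_start_branches[OF conjunct1[OF s1] n T1] _ order_refl], assumption)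
      fix s2
      assume s2: "table n k (\<lambda>v X. if \<exists>j. X = {j} \<and> nats s1 ''T'' j = v then 0 else \<infinity>) (weights s2 ''H'') \<and>
        frame start_branches s1 s2"
      have p2: "prepared n k s2" using prepared_frame[of n k s1 start_branches s2] s1 s2 by simp
      have eq2: "nats s2 ''D'' 0 = D" "nats s2 ''r'' = nats s ''r''" "weights s2 ''E'' = weights s ''E''"
        using frame_nats[of start_branches s1 s2] frame_weights[of start_branches s1 s2] s2 s(3) by (simp_all add: eq1)
      have "table n k (\<lambda>v. branch_opt V E \<tau> 0 (\<nu> v)) (weights s2 ''H'')"
      proof (rule table_cong[OF conjunct1[OF s2]])
        fix v X assume v: "v < n" and X: "X \<subseteq> {..<k}"
        \<comment> \<open>The machine compares vertex numbers and the recurrence compares vertices;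
          injectivity of \<open>\<nu>\<close> on \<open>{..<n}\<close> identifies the two.\<close>
        have "nats s ''T'' j = v \<longleftrightarrow> \<tau> j = \<nu> v" if "j < k" for j
          using \<nu> s(6) that v unfolding \<tau>_def bij_betw_def by (auto simp: inj_on_def)
        then have "(\<exists>j. X = {j} \<and> nats s1 ''T'' j = v) \<longleftrightarrow> (\<exists>j. X = {j} \<and> \<tau> j = \<nu> v)"
          using X by (auto simp: eq1)
        then show "(if \<exists>j. X = {j} \<and> nats s1 ''T'' j = v then 0 else \<infinity>) = branch_opt V E \<tau> 0 (\<nu> v) X"
          by simp
      qed
      then have rounds: "runs rounds s2 (1000 * (3 ^ k * n ^ 3)) (\<lambda>s'.
          table n k (\<lambda>v. tree_opt V E \<tau> (min n D) (\<nu> v)) (weights s' ''F'') \<and> frame rounds s2 s')"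
        using E by (intro runs_rounds[OF p2 n eq2(1) \<nu>]) (simp_all add: eq2)
      show "runs (Seq rounds
     (Seq (WAssign ''opt'' (Const 0)
        (WCell ''F'' (NAdd (NCell ''rowF'' (scalar ''r'')) (NSub (scalar ''K'') (Const 1)))))
     (Cond (WLess (WCell ''opt'' (Const 0)) WInf)
        (NAssign ''fail'' (Const 0) (Const 0))
        (NAssign ''fail'' (Const 0) (Const 1))))) s2 (1000 * (3 ^ k * n ^ 3) + 19)
        (\<lambda>s'. ddcst_solution V E T r D (result s'))"
      proof (rule runs_Seq_mono[OF rounds finish order_refl])
        fix s3
        assume s3: "table n k (\<lambda>v. tree_opt V E \<tau> (min n D) (\<nu> v)) (weights s3 ''F'') \<and> frame rounds s2 s3"
        show "prepared n k s3" using prepared_frame[OF p2, of rounds s3] s3 by simp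
        show "nats s3 ''r'' 0 = nats s ''r'' 0" using frame_nats[of rounds s2 s3 "''r''"] s3 by (simp add: eq2)
      qed blast
    qed
  qed
  moreover have le: "n * 3 ^ k \<le> 3 ^ k * n ^ 3" "1 \<le> 3 ^ k * n ^ 3"
    using n by (auto simp: power3_eq_cube)
  have "210 * (n * 3 ^ k) + (150 * (n * 3 ^ k) + (1000 * (3 ^ k * n ^ 3) + 19)) \<le> 2000 * (3 ^ k * n ^ 3)"
    using le by linarith
  ultimately have "runs ddcst s (2000 * (3 ^ k * n ^ 3)) (\<lambda>s'. ddcst_solution V E T r D (result s'))"
    by (rule runs_mono)
  then show ?thesis by (simp only: n_def k_def)
qed

theorem theorem2:
  shows "\<exists>(p :: com) (C :: nat).
    \<forall>(V :: nat set) (E :: nat \<Rightarrow> nat \<Rightarrow> ennreal) (T :: nat set) (r :: nat) (D :: nat) (s :: store).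
      ddcst_instance V E T r D \<longrightarrow> encodes s V E T r D \<longrightarrow>
      (\<exists>t s'. exec p s t s' \<and>
              ddcst_solution V E T r D (result s') \<and>
              t \<le> C * (3 ^ card T * card V ^ 3))"
proof (rule exI[of _ ddcst], rule exI[of _ 2000], intro allI impI)
  fix V T :: "nat set" and E :: "nat \<Rightarrow> nat \<Rightarrow> ennreal" and r D :: nat and s :: store
  assume "ddcst_instance V E T r D" "encodes s V E T r D"
  then have "runs ddcst s (2000 * (3 ^ card T * card V ^ 3)) (\<lambda>s'. ddcst_solution V E T r D (result s'))"
    by (rule runs_ddcst)
  then show "\<exists>t s'. exec ddcst s t s' \<and> ddcst_solution V E T r D (result s') \<and>
      t \<le> 2000 * (3 ^ card T * card V ^ 3)"
    unfolding runs_def by blast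
qed

end
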